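(* Let $l=l(n)$ and $n$ be such that $l\to\infty$ and $\ln n/\ln l\to\infty$. Then $$D^{\mathrm{tree}}(n,l)=\left(\tfrac12+o(1)\right)\frac{l\ln n}{\ln l}.$$ Moreover, the lower bound is attained by uncolored trees: there are uncolored trees $T$ of order at most $n$ and maximum degree at most $l$ with $D(T)\ge \left(\tfrac12-o(1)\right)\frac{l\ln n}{\ln l}$.
   Context: First order sentences about graphs use variables ranging over vertices, connectives, quantifiers $\exists,\forall$, equality $=$ and adjacency $\sim$. A colored graph additionally carries unary relations (colors) $U_i$, $i\in I$; a vertex may have no color or several colors, and the formulas may use the $U_i$. A sentence $A$ defines a (colored) graph $G$ if $G\models A$ and $H\not\models A$ for every (colored) graph $H$ not isomorphic to $G$ (isomorphisms preserving colors). $D(G)$ is the smallest quantifier depth (maximum number of nested quantifiers) of a sentence defining $G$. $D^{\mathrm{tree}}(n,l)$ is the maximum of $D(T)$ over all colored trees $T$ of order at most $n$ and maximum degree at most $l$. All graphs are finite. *)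

theory Defs
  imports "HOL-Library.Landau_Symbols"
begin

text \<open>
  Finite graphs are represented, up to isomorphism, on vertex sets that are finite sets of natural
  numbers. A set \<^term>\<open>I :: nat set\<close> of color names is a parameter; only the relations
  \<^term>\<open>color G i\<close> with \<^term>\<open>i \<in> I\<close> belong to the structure. In particular,
  for \<^term>\<open>I = {}\<close> one obtains uncolored graphs and the field \<open>color\<close> is ignored.
\<close>

record colored_graph =
  verts :: "nat set"
  adj :: "nat \<Rightarrow> nat \<Rightarrow> bool"
  color :: "nat \<Rightarrow> nat set"

text \<open>As usual for first order structures, the vertex set is nonempty.\<close>

definition is_colored_graph :: "nat set \<Rightarrow> colored_graph \<Rightarrow> bool" where
  "is_colored_graph I G \<longleftrightarrow>
     finite (verts G) \<and> verts G \<noteq> {} \<and>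
     (\<forall>u v. adj G u v \<longrightarrow> u \<in> verts G \<and> v \<in> verts G) \<and>
     (\<forall>u v. adj G u v \<longrightarrow> adj G v u) \<and>
     (\<forall>v. \<not> adj G v v) \<and>
     (\<forall>i\<in>I. color G i \<subseteq> verts G)"

definition isomorphic :: "nat set \<Rightarrow> colored_graph \<Rightarrow> colored_graph \<Rightarrow> bool" where
  "isomorphic I G H \<longleftrightarrow>
     (\<exists>f. bij_betw f (verts G) (verts H) \<and>
          (\<forall>u\<in>verts G. \<forall>v\<in>verts G. adj G u v \<longleftrightarrow> adj H (f u) (f v)) \<and>
          (\<forall>i\<in>I. \<forall>v\<in>verts G. v \<in> color G i \<longleftrightarrow> f v \<in> color H i))"

datatype formula =
    Eq nat nat
  | Adj nat nat
  | Col nat nat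
  | Neg formula
  | Conj formula formula
  | Disj formula formula
  | Imp formula formula
  | Exi nat formula
  | All nat formula

text \<open>In \<^term>\<open>Col i x\<close>, \<open>i\<close> is the color name and \<open>x\<close> the variable.\<close>

primrec sat :: "colored_graph \<Rightarrow> (nat \<Rightarrow> nat) \<Rightarrow> formula \<Rightarrow> bool" where
  "sat G s (Eq x y) \<longleftrightarrow> s x = s y"
| "sat G s (Adj x y) \<longleftrightarrow> adj G (s x) (s y)"
| "sat G s (Col i x) \<longleftrightarrow> s x \<in> color G i"
| "sat G s (Neg A) \<longleftrightarrow> \<not> sat G s A"
| "sat G s (Conj A B) \<longleftrightarrow> sat G s A \<and> sat G s B"
| "sat G s (Disj A B) \<longleftrightarrow> sat G s A \<or> sat G s B"
| "sat G s (Imp A B) \<longleftrightarrow> (sat G s A \<longrightarrow> sat G s B)"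
| "sat G s (Exi x A) \<longleftrightarrow> (\<exists>v\<in>verts G. sat G (s(x := v)) A)"
| "sat G s (All x A) \<longleftrightarrow> (\<forall>v\<in>verts G. sat G (s(x := v)) A)"

primrec free_vars :: "formula \<Rightarrow> nat set" where
  "free_vars (Eq x y) = {x, y}"
| "free_vars (Adj x y) = {x, y}"
| "free_vars (Col i x) = {x}"
| "free_vars (Neg A) = free_vars A"
| "free_vars (Conj A B) = free_vars A \<union> free_vars B"
| "free_vars (Disj A B) = free_vars A \<union> free_vars B"
| "free_vars (Imp A B) = free_vars A \<union> free_vars B"
| "free_vars (Exi x A) = free_vars A - {x}"
| "free_vars (All x A) = free_vars A - {x}"

primrec colors_of :: "formula \<Rightarrow> nat set" where
  "colors_of (Eq x y) = {}"
| "colors_of (Adj x y) = {}"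
| "colors_of (Col i x) = {i}"
| "colors_of (Neg A) = colors_of A"
| "colors_of (Conj A B) = colors_of A \<union> colors_of B"
| "colors_of (Disj A B) = colors_of A \<union> colors_of B"
| "colors_of (Imp A B) = colors_of A \<union> colors_of B"
| "colors_of (Exi x A) = colors_of A"
| "colors_of (All x A) = colors_of A"

primrec quantifier_depth :: "formula \<Rightarrow> nat" where
  "quantifier_depth (Eq x y) = 0"
| "quantifier_depth (Adj x y) = 0"
| "quantifier_depth (Col i x) = 0"
| "quantifier_depth (Neg A) = quantifier_depth A"
| "quantifier_depth (Conj A B) = max (quantifier_depth A) (quantifier_depth B)"
| "quantifier_depth (Disj A B) = max (quantifier_depth A) (quantifier_depth B)"
| "quantifier_depth (Imp A B) = max (quantifier_depth A) (quantifier_depth B)"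
| "quantifier_depth (Exi x A) = Suc (quantifier_depth A)"
| "quantifier_depth (All x A) = Suc (quantifier_depth A)"

definition is_sentence :: "nat set \<Rightarrow> formula \<Rightarrow> bool" where
  "is_sentence I A \<longleftrightarrow> free_vars A = {} \<and> colors_of A \<subseteq> I"

definition models :: "colored_graph \<Rightarrow> formula \<Rightarrow> bool" where
  "models G A \<longleftrightarrow> (\<forall>s. range s \<subseteq> verts G \<longrightarrow> sat G s A)"

definition defines_graph :: "nat set \<Rightarrow> formula \<Rightarrow> colored_graph \<Rightarrow> bool" where
  "defines_graph I A G \<longleftrightarrow>
     models G A \<and>
     (\<forall>H. is_colored_graph I H \<and> \<not> isomorphic I G H \<longrightarrow> \<not> models H A)"

text \<open>
  For finite \<open>I\<close>, every finite graph is defined by some sentence, of depth at most its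
  order plus one; so the minimum is attained. (For infinite \<open>I\<close> no graph is definable, as a
  sentence mentions only finitely many colors.)
\<close>

definition def_depth :: "nat set \<Rightarrow> colored_graph \<Rightarrow> nat" where
  "def_depth I G = (LEAST d. \<exists>A. is_sentence I A \<and> defines_graph I A G \<and> quantifier_depth A = d)"

definition connected_graph :: "colored_graph \<Rightarrow> bool" where
  "connected_graph G \<longleftrightarrow> (\<forall>u\<in>verts G. \<forall>v\<in>verts G. (adj G)\<^sup>*\<^sup>* u v)"

definition is_cycle :: "colored_graph \<Rightarrow> nat list \<Rightarrow> bool" where
  "is_cycle G c \<longleftrightarrow>
     length c \<ge> 3 \<and> distinct c \<and> set c \<subseteq> verts G \<and>
     (\<forall>i<length c. adj G (c ! i) (c ! (Suc i mod length c)))"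

definition is_colored_tree :: "nat set \<Rightarrow> colored_graph \<Rightarrow> bool" where
  "is_colored_tree I T \<longleftrightarrow>
     is_colored_graph I T \<and> connected_graph T \<and> (\<nexists>c. is_cycle T c)"

definition degree :: "colored_graph \<Rightarrow> nat \<Rightarrow> nat" where
  "degree G v = card {w \<in> verts G. adj G v w}"

definition trees_upto :: "nat set \<Rightarrow> nat \<Rightarrow> nat \<Rightarrow> colored_graph set" where
  "trees_upto I n l =
     {T. is_colored_tree I T \<and> card (verts T) \<le> n \<and> (\<forall>v\<in>verts T. degree T v \<le> l)}"

text \<open>
  The maximum ranges over all finite color sets as well. The set is finite, its elements
  being at most \<^term>\<open>n + 1\<close>, and nonempty for \<^term>\<open>n \<ge> 1\<close>.
\<close>

definition D_tree :: "nat \<Rightarrow> nat \<Rightarrow> nat" where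
  "D_tree n l = Max {def_depth I T | I T. finite I \<and> T \<in> trees_upto I n l}"

end

(*
  Both bounds are proved with the Ehrenfeucht game, Duplicator's wins being described by the
  back-and-forth relation and turned into sentences by Hintikka formulas.

  Lower bound: build two rooted trees recursively, one from h + 1 copies of the first and h copies of
  the second tree of the previous level, the other with the multiplicities exchanged (2 h + 2 = l).
  Duplicator can hide the difference for h rounds at every level, and there are ln n / ln l levels.

  Upper bound: Spoiler pebbles a centroid of the smaller one of two non-isomorphic components. As the
  multisets of types of the branches differ, he can force a pair of non-isomorphic branches by pebbling
  k <= (l + 1) / 2 neighbours, and one of the two branches has at most 1 / max 2 k of the size of the
  smaller component. As k / ln k is increasing, k = (l + 1) / 2 is the worst case.
*)
theory Submission
  imports Defs "HOL-Library.Nat_Bijection" "HOL-Real_Asymp.Real_Asymp"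
begin

subsection \<open>Back-and-forth games and definability\<close>

text \<open>The main term comes from a potential. One stage of Spoiler costs 1 + k moves, a centroid
  and k neighbours, and divides the size of the smaller component by at least max 2 k. With K = (l +
  1) / 2 and \<alpha> = K / ln K + 1 / ln 2, every stage satisfies 1 + k \<le> \<alpha> * ln (max 2
  k), so all stages together cost at most \<alpha> * ln n. The obstacle is that the second graph is
  arbitrary: neither acyclicity nor connectedness nor a degree bound is given. They are enforced by
  threats costing O(ln n) or l + 1 rounds. A threat that is carried out wins at once, so it is paid
  for only once, and O(ln n) + l is negligible against l * ln n / ln l because l and ln n / ln l
  tend to infinity. In the lower bound, 2 h + 1 branches leave h spare copies of both types besides
  the exceptional pair, hence about l / 2 rounds per level. As \<open>def_depth\<close> is a least
  element, this bound also needs the existence of some defining sentence, which the upper bound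
  supplies.\<close>

text \<open>\<open>R\<close> is the set of pairs of elements pebbled so far; \<open>P R\<close> says that Duplicator has not
  lost yet.\<close>

primrec game :: "'a set \<Rightarrow> 'b set \<Rightarrow> (('a \<times> 'b) set \<Rightarrow> bool) \<Rightarrow> nat \<Rightarrow> ('a \<times> 'b) set \<Rightarrow> bool" where
  "game X Y P 0 R \<longleftrightarrow> P R"
| "game X Y P (Suc d) R \<longleftrightarrow>
     (\<forall>x\<in>X. \<exists>y\<in>Y. game X Y P d (insert (x, y) R)) \<and>
     (\<forall>y\<in>Y. \<exists>x\<in>X. game X Y P d (insert (x, y) R))"

definition partial_iso :: "nat set \<Rightarrow> colored_graph \<Rightarrow> colored_graph \<Rightarrow> (nat \<times> nat) set \<Rightarrow> bool" where
  "partial_iso I G H R \<longleftrightarrow>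
     (\<forall>u u'. (u, u') \<in> R \<longrightarrow>
       (\<forall>v v'. (v, v') \<in> R \<longrightarrow> (u = v \<longleftrightarrow> u' = v') \<and> (adj G u v \<longleftrightarrow> adj H u' v')) \<and>
       (\<forall>i\<in>I. u \<in> color G i \<longleftrightarrow> u' \<in> color H i))"

abbreviation bf :: "nat set \<Rightarrow> colored_graph \<Rightarrow> colored_graph \<Rightarrow> nat \<Rightarrow> (nat \<times> nat) set \<Rightarrow> bool" where
  "bf I G H \<equiv> game (verts G) (verts H) (partial_iso I G H)"

lemma partial_isoD:
  assumes "partial_iso I G H R" "(u, u') \<in> R"
  shows partial_iso_eq: "(v, v') \<in> R \<Longrightarrow> u = v \<longleftrightarrow> u' = v'"
    and partial_iso_adj: "(v, v') \<in> R \<Longrightarrow> adj G u v \<longleftrightarrow> adj H u' v'"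
    and partial_iso_color: "i \<in> I \<Longrightarrow> u \<in> color G i \<longleftrightarrow> u' \<in> color H i"
  using assms unfolding partial_iso_def by blast+

lemma partial_iso_subset: "\<forall>R R'. partial_iso I G H R' \<longrightarrow> R \<subseteq> R' \<longrightarrow> partial_iso I G H R"
  unfolding partial_iso_def by blast

lemma game_subset:
  assumes "\<forall>R R'. P R' \<longrightarrow> R \<subseteq> R' \<longrightarrow> P R" "game X Y P d R'" "R \<subseteq> R'"
  shows "game X Y P d R"
  using assms(2,3)
proof (induction d arbitrary: R R')
  case 0
  then show ?case using assms(1) unfolding game.simps by blast
next
  case (Suc d)
  have "game X Y P d (insert z R)" if "game X Y P d (insert z R')" for z
    using Suc.IH[OF that] Suc.prems(2) by blast
  then show ?case using Suc.prems(1) unfolding game.simps by fast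
qed

lemmas bf_subset = game_subset[OF partial_iso_subset]

text \<open>\<open>P\<close> is tested only in the final position, so shortening the game rests on
  \<open>P\<close> being inherited by subsets: play an arbitrary round and forget its pebbles. With
  \<open>X\<close> empty there is no such round, and the longer game could be won vacuously.\<close>

lemma game_Suc_imp:
  assumes "\<forall>R R'. P R' \<longrightarrow> R \<subseteq> R' \<longrightarrow> P R" "X \<noteq> {}" "game X Y P (Suc d) R"
  shows "game X Y P d R"
proof -
  obtain x y where "game X Y P d (insert (x, y) R)" using assms(2,3) unfolding game.simps by blast
  then show ?thesis by (rule game_subset[OF assms(1)]) blast
qed

lemma bf_le:
  assumes "verts G \<noteq> {}" "bf I G H d R" "e \<le> d"
  shows "bf I G H e R"
  using assms(3,2)
proof (induction d)
  case (Suc d)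
  then show ?case
    using game_Suc_imp[OF partial_iso_subset assms(1), of "verts H" I G H d R] le_Suc_eq by blast
qed simp

lemma bf_partial_iso: "verts G \<noteq> {} \<Longrightarrow> bf I G H d R \<Longrightarrow> partial_iso I G H R"
  using bf_le[where e=0] by fastforce

lemma game_converse:
  assumes "\<And>R. P R \<longleftrightarrow> Q (R\<inverse>)"
  shows "game X Y P d R \<longleftrightarrow> game Y X Q d (R\<inverse>)"
proof (induction d arbitrary: R)
  case 0
  then show ?case using assms by simp
next
  case (Suc d)
  have "(insert (x, y) R)\<inverse> = insert (y, x) (R\<inverse>)" for x y by auto
  then have "game X Y P d (insert (x, y) R) \<longleftrightarrow> game Y X Q d (insert (y, x) (R\<inverse>))" for x y
    using Suc.IH[of "insert (x, y) R"] by simp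
  then show ?case unfolding game.simps by blast
qed

lemma partial_iso_converse: "partial_iso I G H R \<longleftrightarrow> partial_iso I H G (R\<inverse>)"
  unfolding partial_iso_def by fast

lemma bf_converse: "bf I G H d R \<longleftrightarrow> bf I H G d (R\<inverse>)"
  by (rule game_converse) (rule partial_iso_converse)

text \<open>Spoiler spends \<open>card S\<close> rounds on the elements of \<open>S\<close>; as each
  of them is played once, the answers form a function.\<close>

lemma game_choose_left:
  assumes "finite S" "S \<subseteq> X" "game X Y P (d + card S) R"
  shows "\<exists>f. f ` S \<subseteq> Y \<and> game X Y P d (R \<union> (\<lambda>u. (u, f u)) ` S)"
  using assms
proof (induction S arbitrary: R rule: finite_induct)
  case (insert x S)
  from insert obtain y where y: "y \<in> Y" "game X Y P (d + card S) (insert (x, y) R)" by auto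
  with insert.IH insert.prems(1) obtain f where
    f: "f ` S \<subseteq> Y" "game X Y P d (insert (x, y) R \<union> (\<lambda>u. (u, f u)) ` S)" by blast
  have "(\<lambda>u. (u, (f(x := y)) u)) ` insert x S = insert (x, y) ((\<lambda>u. (u, f u)) ` S)"
    using insert.hyps(2) by auto
  then have "(f(x := y)) ` insert x S \<subseteq> Y \<and> game X Y P d (R \<union> (\<lambda>u. (u, (f(x := y)) u)) ` insert x S)"
    using f y insert.hyps(2) by auto
  then show ?case by blast
qed auto

lemma bf_choose_right:
  assumes "finite S" "S \<subseteq> verts H" "bf I G H (d + card S) R"
  shows "\<exists>f. f ` S \<subseteq> verts G \<and> bf I G H d (R \<union> (\<lambda>u. (f u, u)) ` S)"
proof -
  have "bf I H G (d + card S) (R\<inverse>)" using assms(3) by (subst (asm) bf_converse)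
  from game_choose_left[OF assms(1,2) this] obtain f where
    f: "f ` S \<subseteq> verts G" "bf I H G d (R\<inverse> \<union> (\<lambda>u. (u, f u)) ` S)" by blast
  moreover have "(R \<union> (\<lambda>u. (f u, u)) ` S)\<inverse> = R\<inverse> \<union> (\<lambda>u. (u, f u)) ` S" by auto
  ultimately have "bf I G H d (R \<union> (\<lambda>u. (f u, u)) ` S)" by (subst bf_converse) simp
  then show ?thesis using f(1) by blast
qed

section \<open>Game equivalence versus truth of formulas: Hintikka formulas\<close>

lemma bf_sat:
  assumes "verts G \<noteq> {}"
  shows "bf I G H d R \<Longrightarrow> quantifier_depth A \<le> d \<Longrightarrow> colors_of A \<subseteq> I
    \<Longrightarrow> \<forall>x\<in>free_vars A. (s x, t x) \<in> R \<Longrightarrow> sat G s A \<longleftrightarrow> sat H t A"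
proof (induction A arbitrary: d R s t)
  case (Eq x y)
  then show ?case using partial_iso_eq[OF bf_partial_iso[OF assms Eq(1)]] by auto
next
  case (Adj x y)
  then show ?case using partial_iso_adj[OF bf_partial_iso[OF assms Adj(1)]] by auto
next
  case (Col i x)
  then show ?case using partial_iso_color[OF bf_partial_iso[OF assms Col(1)]] by auto
next
  case (Exi x A)
  then obtain e where e: "d = Suc e" by (cases d) auto
  have "sat G (s(x := v)) A \<longleftrightarrow> sat H (t(x := w)) A" if "bf I G H e (insert (v, w) R)" for v w
    by (rule Exi.IH[OF that]) (use Exi.prems e in auto)
  then show ?case using Exi.prems(1) unfolding e game.simps sat.simps by blast
next
  case (All x A)
  then obtain e where e: "d = Suc e" by (cases d) auto
  have "sat G (s(x := v)) A \<longleftrightarrow> sat H (t(x := w)) A" if "bf I G H e (insert (v, w) R)" for v w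
    by (rule All.IH[OF that]) (use All.prems e in auto)
  then show ?case using All.prems(1) unfolding e game.simps sat.simps by blast
next
  case (Neg A)
  have "sat G s A = sat H t A" by (rule Neg.IH[OF Neg.prems(1)]) (use Neg.prems in auto)
  then show ?case by simp
next
  case (Conj A B)
  have "sat G s A = sat H t A" by (rule Conj.IH(1)[OF Conj.prems(1)]) (use Conj.prems in auto)
  moreover have "sat G s B = sat H t B" by (rule Conj.IH(2)[OF Conj.prems(1)]) (use Conj.prems in auto)
  ultimately show ?case by simp
next
  case (Disj A B)
  have "sat G s A = sat H t A" by (rule Disj.IH(1)[OF Disj.prems(1)]) (use Disj.prems in auto)
  moreover have "sat G s B = sat H t B" by (rule Disj.IH(2)[OF Disj.prems(1)]) (use Disj.prems in auto)
  ultimately show ?case by simp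
next
  case (Imp A B)
  have "sat G s A = sat H t A" by (rule Imp.IH(1)[OF Imp.prems(1)]) (use Imp.prems in auto)
  moreover have "sat G s B = sat H t B" by (rule Imp.IH(2)[OF Imp.prems(1)]) (use Imp.prems in auto)
  ultimately show ?case by simp
qed

text \<open>The syntax has no truth constant, so with neither a free variable nor a quantifier
  nothing expresses the empty conjunction. Hence the nonemptiness here, \<open>k + d \<ge> 1\<close>
  in \<open>hintikka\<close> and \<open>d \<ge> 1\<close> in
  \<open>defining_sentence_exists\<close>.\<close>

lemma finite_conj:
  assumes "finite \<Phi>" "\<Phi> \<noteq> {}"
    and "\<forall>\<phi>\<in>\<Phi>. free_vars \<phi> \<subseteq> F \<and> colors_of \<phi> \<subseteq> I \<and> quantifier_depth \<phi> \<le> d"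
  shows "\<exists>\<psi>. free_vars \<psi> \<subseteq> F \<and> colors_of \<psi> \<subseteq> I \<and> quantifier_depth \<psi> \<le> d \<and>
           (\<forall>H t. sat H t \<psi> \<longleftrightarrow> (\<forall>\<phi>\<in>\<Phi>. sat H t \<phi>))"
  using assms
proof (induction \<Phi> rule: finite_ne_induct)
  case (singleton x)
  then show ?case by (intro exI[of _ x]) simp
next
  case (insert x \<Phi>)
  then obtain \<psi> where "free_vars \<psi> \<subseteq> F \<and> colors_of \<psi> \<subseteq> I \<and> quantifier_depth \<psi> \<le> d \<and>
           (\<forall>H t. sat H t \<psi> \<longleftrightarrow> (\<forall>\<phi>\<in>\<Phi>. sat H t \<phi>))" by auto
  then show ?case using insert.prems by (intro exI[of _ "Conj x \<psi>"]) simp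
qed

lemma finite_disj:
  assumes "finite \<Phi>" "\<Phi> \<noteq> {}"
    and "\<forall>\<phi>\<in>\<Phi>. free_vars \<phi> \<subseteq> F \<and> colors_of \<phi> \<subseteq> I \<and> quantifier_depth \<phi> \<le> d"
  shows "\<exists>\<psi>. free_vars \<psi> \<subseteq> F \<and> colors_of \<psi> \<subseteq> I \<and> quantifier_depth \<psi> \<le> d \<and>
           (\<forall>H t. sat H t \<psi> \<longleftrightarrow> (\<exists>\<phi>\<in>\<Phi>. sat H t \<phi>))"
proof -
  from assms have "\<forall>\<phi>\<in>Neg ` \<Phi>. free_vars \<phi> \<subseteq> F \<and> colors_of \<phi> \<subseteq> I \<and> quantifier_depth \<phi> \<le> d"
    by simp
  from finite_conj[OF _ _ this] assms(1,2) obtain \<psi> where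
    "free_vars \<psi> \<subseteq> F \<and> colors_of \<psi> \<subseteq> I \<and> quantifier_depth \<psi> \<le> d \<and>
      (\<forall>H t. sat H t \<psi> \<longleftrightarrow> (\<forall>\<phi>\<in>Neg ` \<Phi>. sat H t \<phi>))" by auto
  then show ?thesis by (intro exI[of _ "Neg \<psi>"]) simp
qed

lemma hintikka_base:
  assumes "finite I" "k \<ge> 1"
  shows "\<exists>\<phi>. free_vars \<phi> \<subseteq> {..<k} \<and> colors_of \<phi> \<subseteq> I \<and> quantifier_depth \<phi> \<le> 0 \<and>
    (\<forall>H t. sat H t \<phi> \<longleftrightarrow> partial_iso I G H ((\<lambda>x. (s x, t x)) ` {..<k}))"
proof -
  define lit where "lit b \<phi> = (if b then \<phi> else Neg \<phi>)" for b \<phi>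
  have sat_lit: "sat H t (lit b \<phi>) \<longleftrightarrow> (b \<longleftrightarrow> sat H t \<phi>)" for H t b \<phi>
    by (simp add: lit_def)
  have lit: "free_vars (lit b \<phi>) = free_vars \<phi>" "colors_of (lit b \<phi>) = colors_of \<phi>"
      "quantifier_depth (lit b \<phi>) = quantifier_depth \<phi>" for b \<phi>
    by (simp_all add: lit_def)
  define \<Phi> where "\<Phi> = (\<lambda>(x, y). lit (s x = s y) (Eq x y)) ` ({..<k} \<times> {..<k})
    \<union> (\<lambda>(x, y). lit (adj G (s x) (s y)) (Adj x y)) ` ({..<k} \<times> {..<k})
    \<union> (\<lambda>(i, x). lit (s x \<in> color G i) (Col i x)) ` (I \<times> {..<k})"
  have fin: "finite \<Phi>" unfolding \<Phi>_def using assms(1) by simp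
  have ne: "\<Phi> \<noteq> {}" unfolding \<Phi>_def using assms(2) by (auto simp: lessThan_empty_iff)
  have "\<forall>\<phi>\<in>\<Phi>. free_vars \<phi> \<subseteq> {..<k} \<and> colors_of \<phi> \<subseteq> I \<and> quantifier_depth \<phi> \<le> 0"
    unfolding \<Phi>_def by (auto simp: lit)
  from finite_conj[OF fin ne this] obtain \<psi> where
    \<psi>: "free_vars \<psi> \<subseteq> {..<k} \<and> colors_of \<psi> \<subseteq> I \<and> quantifier_depth \<psi> \<le> 0 \<and>
      (\<forall>H t. sat H t \<psi> \<longleftrightarrow> (\<forall>\<phi>\<in>\<Phi>. sat H t \<phi>))" by (elim exE)
  have "(\<forall>\<phi>\<in>\<Phi>. sat H t \<phi>) \<longleftrightarrow> partial_iso I G H ((\<lambda>x. (s x, t x)) ` {..<k})" for H t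
  proof -
    have img: "(\<forall>u u'. (u, u') \<in> (\<lambda>x. (s x, t x)) ` {..<k} \<longrightarrow> Q u u') \<longleftrightarrow> (\<forall>x<k. Q (s x) (t x))" for Q
      by auto
    have img2: "(\<forall>\<phi>\<in>(\<lambda>(x, y). F x y) ` (A \<times> B). Q \<phi>) \<longleftrightarrow> (\<forall>x\<in>A. \<forall>y\<in>B. Q (F x y))"
      for A :: "nat set" and B :: "nat set" and F :: "nat \<Rightarrow> nat \<Rightarrow> formula" and Q
      by auto
    have "(\<forall>\<phi>\<in>\<Phi>. sat H t \<phi>) \<longleftrightarrow> (\<forall>x<k. \<forall>y<k. s x = s y \<longleftrightarrow> t x = t y) \<and>
        (\<forall>x<k. \<forall>y<k. adj G (s x) (s y) \<longleftrightarrow> adj H (t x) (t y)) \<and>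
        (\<forall>i\<in>I. \<forall>x<k. s x \<in> color G i \<longleftrightarrow> t x \<in> color H i)"
      unfolding \<Phi>_def ball_Un img2 sat_lit sat.simps by blast
    then show ?thesis unfolding partial_iso_def img by blast
  qed
  then show ?thesis using \<psi> by (intro exI[of _ \<psi>]) simp
qed

text \<open>The recursion copies the two clauses of the game: a conjunction of existential formulas
  for the moves in \<open>G\<close>, and one universal formula whose body is the disjunction of the
  possible answers in \<open>G\<close>. Both range over the finite \<open>G\<close>, so one formula
  serves every \<open>H\<close>.\<close>

lemma hintikka:
  assumes "finite I" "finite (verts G)" "verts G \<noteq> {}"
  shows "k + d \<ge> 1 \<Longrightarrow> \<exists>\<phi>. free_vars \<phi> \<subseteq> {..<k} \<and> colors_of \<phi> \<subseteq> I \<and> quantifier_depth \<phi> \<le> d \<and>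
    (\<forall>H t. sat H t \<phi> \<longleftrightarrow> bf I G H d ((\<lambda>x. (s x, t x)) ` {..<k}))"
proof (induction d arbitrary: k s)
  case 0
  then show ?case using hintikka_base[OF assms(1)] by simp
next
  case (Suc d)
  have "\<forall>v. \<exists>\<phi>. free_vars \<phi> \<subseteq> {..<Suc k} \<and> colors_of \<phi> \<subseteq> I \<and> quantifier_depth \<phi> \<le> d \<and>
    (\<forall>H t. sat H t \<phi> \<longleftrightarrow> bf I G H d ((\<lambda>x. ((s(k := v)) x, t x)) ` {..<Suc k}))"
    by (intro allI Suc.IH) simp
  then obtain \<phi> where \<phi>: "\<And>v. free_vars (\<phi> v) \<subseteq> {..<Suc k} \<and> colors_of (\<phi> v) \<subseteq> I \<and>
      quantifier_depth (\<phi> v) \<le> d \<and>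
      (\<forall>H t. sat H t (\<phi> v) \<longleftrightarrow> bf I G H d ((\<lambda>x. ((s(k := v)) x, t x)) ` {..<Suc k}))"
    by metis
  have upd: "(\<lambda>x. ((s(k := v)) x, (t(k := w)) x)) ` {..<Suc k} =
      insert (v, w) ((\<lambda>x. (s x, t x)) ` {..<k})" for v w t
    by (force simp: lessThan_Suc)
  have fv: "free_vars (\<phi> v) - {k} \<subseteq> {..<k}" for v using \<phi>[of v] by (auto simp: lessThan_Suc)
  have "\<forall>\<psi>\<in>(\<lambda>v. Exi k (\<phi> v)) ` verts G. free_vars \<psi> \<subseteq> {..<k} \<and> colors_of \<psi> \<subseteq> I \<and>
      quantifier_depth \<psi> \<le> Suc d"
    using \<phi> fv by auto
  from finite_conj[OF _ _ this] assms obtain \<psi>1 where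
    \<psi>1: "free_vars \<psi>1 \<subseteq> {..<k} \<and> colors_of \<psi>1 \<subseteq> I \<and> quantifier_depth \<psi>1 \<le> Suc d \<and>
      (\<forall>H t. sat H t \<psi>1 \<longleftrightarrow> (\<forall>v\<in>verts G. sat H t (Exi k (\<phi> v))))" by auto
  have "\<forall>\<psi>\<in>\<phi> ` verts G. free_vars \<psi> \<subseteq> {..<Suc k} \<and> colors_of \<psi> \<subseteq> I \<and> quantifier_depth \<psi> \<le> d"
    using \<phi> by auto
  from finite_disj[OF _ _ this] assms obtain \<psi>2 where
    \<psi>2: "free_vars \<psi>2 \<subseteq> {..<Suc k} \<and> colors_of \<psi>2 \<subseteq> I \<and> quantifier_depth \<psi>2 \<le> d \<and>
      (\<forall>H t. sat H t \<psi>2 \<longleftrightarrow> (\<exists>v\<in>verts G. sat H t (\<phi> v)))" by auto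
  have "sat H (t(k := w)) (\<phi> v) \<longleftrightarrow> bf I G H d (insert (v, w) ((\<lambda>x. (s x, t x)) ` {..<k}))" for H t v w
    using \<phi>[of v] unfolding upd[symmetric] by blast
  then have "sat H t (Conj \<psi>1 (All k \<psi>2)) \<longleftrightarrow> bf I G H (Suc d) ((\<lambda>x. (s x, t x)) ` {..<k})" for H t
    using \<psi>1 \<psi>2 by simp
  moreover have "free_vars (Conj \<psi>1 (All k \<psi>2)) \<subseteq> {..<k}" using \<psi>1 \<psi>2 by (auto simp: lessThan_Suc)
  ultimately show ?case using \<psi>1 \<psi>2 by (intro exI[of _ "Conj \<psi>1 (All k \<psi>2)"]) simp
qed

lemma defining_sentence_exists:
  assumes "finite I" "is_colored_graph I G" "d \<ge> 1"
    and "\<And>H. is_colored_graph I H \<Longrightarrow> bf I G H d {} \<Longrightarrow> isomorphic I G H"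
  shows "\<exists>A. is_sentence I A \<and> defines_graph I A G \<and> quantifier_depth A \<le> d"
proof -
  have ne: "finite (verts G)" "verts G \<noteq> {}" using assms(2) by (auto simp: is_colored_graph_def)
  obtain A where A: "free_vars A \<subseteq> {..<0}" "colors_of A \<subseteq> I" "quantifier_depth A \<le> d"
    "\<And>H t. sat H t A \<longleftrightarrow> bf I G H d ((\<lambda>x. (x, t x)) ` {..<0})"
    using hintikka[OF assms(1) ne, of 0 d "\<lambda>x. x"] assms(3) by auto
  \<comment> \<open>Copying is a winning strategy on \<open>G\<close> against itself; hence
    \<open>A\<close> is true in \<open>G\<close>.\<close>
  have "bf I G G e (Id_on U)" if "U \<subseteq> verts G" for e U
    using that
  proof (induction e arbitrary: U)
    case 0
    then show ?case by (auto simp: partial_iso_def)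
  next
    case (Suc e)
    have "insert (v, v) (Id_on U) = Id_on (insert v U)" for v by auto
    then show ?case using Suc by (auto intro!: bexI)
  qed
  from this[of "{}"] have "models G A" using A(4) by (auto simp: models_def)
  moreover have "\<not> models H A" if H: "is_colored_graph I H" "\<not> isomorphic I G H" for H
  proof -
    obtain v where "v \<in> verts H" using H(1) by (auto simp: is_colored_graph_def)
    then have "range (\<lambda>_. v) \<subseteq> verts H" by auto
    moreover have "\<not> sat H t A" for t using assms(4)[OF H(1)] H(2) A(4) by auto
    ultimately show ?thesis unfolding models_def by blast
  qed
  ultimately show ?thesis
    using A by (intro exI[of _ A]) (auto simp: is_sentence_def defines_graph_def)
qed

lemma def_depth_le:
  assumes "is_sentence I A" "defines_graph I A G"
  shows "def_depth I G \<le> quantifier_depth A"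
  unfolding def_depth_def by (rule Least_le) (use assms in blast)

text \<open>\<open>LEAST\<close> has a meaningful value only if some defining sentence exists, so
  one is assumed. A defining sentence of depth at most \<open>d\<close> would be true in
  \<open>H\<close> as well by \<open>bf_sat\<close>.\<close>

lemma def_depth_greater:
  assumes "is_sentence I A" "defines_graph I A G"
    and "is_colored_graph I G" "is_colored_graph I H" "\<not> isomorphic I G H" "bf I G H d {}"
  shows "d < def_depth I G"
proof (rule ccontr)
  assume less: "\<not> ?thesis"
  have "\<exists>B. is_sentence I B \<and> defines_graph I B G \<and> quantifier_depth B = def_depth I G"
    unfolding def_depth_def by (rule LeastI_ex) (use assms(1,2) in blast)
  then obtain B where B: "is_sentence I B" "defines_graph I B G" "quantifier_depth B \<le> d"
    using less by auto
  obtain v where v: "v \<in> verts G" using assms(3) by (auto simp: is_colored_graph_def)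
  have "sat G (\<lambda>_. v) B" using B(2) v by (auto simp: defines_graph_def models_def)
  moreover have "sat G (\<lambda>_. v) B \<longleftrightarrow> sat H t B" for t
    by (rule bf_sat[OF _ assms(6) B(3)]) (use v B(1) in \<open>auto simp: is_sentence_def\<close>)
  ultimately have "models H B" by (auto simp: models_def)
  then show False using B(2) assms(4,5) by (auto simp: defines_graph_def)
qed

subsection \<open>Trees that are hard to distinguish\<close>

text \<open>A rooted tree is a prefix-closed set of lists of natural numbers, with root \<open>[]\<close>.\<close>

definition node :: "nat \<Rightarrow> (nat \<Rightarrow> nat list set) \<Rightarrow> nat list set" where
  "node m f = insert [] {k # p | k p. k < m \<and> p \<in> f k}"

definition list_adj :: "nat list \<Rightarrow> nat list \<Rightarrow> bool" where
  "list_adj p q \<longleftrightarrow> (\<exists>k. q = p @ [k] \<or> p = q @ [k])"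

definition list_iso :: "(nat list \<times> nat list) set \<Rightarrow> bool" where
  "list_iso R \<longleftrightarrow> (\<forall>p q. (p, q) \<in> R \<longrightarrow> (\<forall>p' q'. (p', q') \<in> R \<longrightarrow>
     (p = p' \<longleftrightarrow> q = q') \<and> (list_adj p p' \<longleftrightarrow> list_adj q q')))"

lemma list_iso_subset: "\<forall>R R'. list_iso R' \<longrightarrow> R \<subseteq> R' \<longrightarrow> list_iso R"
  unfolding list_iso_def by blast

lemma list_adj_simps [simp]:
  "\<not> list_adj [] []"
  "list_adj [] (k # p) \<longleftrightarrow> p = []"
  "list_adj (k # p) [] \<longleftrightarrow> p = []"
  "list_adj (k # p) (k' # p') \<longleftrightarrow> k = k' \<and> list_adj p p'"
  by (auto simp: list_adj_def)

lemma Nil_in_node [simp]: "[] \<in> node m f"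
  and Cons_in_node [simp]: "k # p \<in> node m f \<longleftrightarrow> k < m \<and> p \<in> f k"
  by (auto simp: node_def)

lemma node_cases:
  assumes "x \<in> node m f"
  obtains "x = []" | k p where "x = k # p" "k < m" "p \<in> f k"
  using assms by (auto simp: node_def)

text \<open>Duplicator copies in the equal branches and follows the given strategy in the pair
  \<open>e\<close>, \<open>\<pi> e\<close>. \<open>W S\<close> pretends that all copied pairs are
  pebbled already: this costs no rounds and leaves \<open>S\<close> as the only changing part of the
  position. Having \<open>([], [])\<close> in \<open>S\<close> matches the branch roots, hence
  adjacency to the common root.\<close>

lemma node_game_exceptional:
  fixes S :: "(nat list \<times> nat list) set"
  assumes bij: "bij_betw \<pi> {..<m} {..<m}" and e: "e < m"
    and eq: "\<And>k. k < m \<Longrightarrow> k \<noteq> e \<Longrightarrow> f k = g (\<pi> k)" and ne: "[] \<in> f e"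
  defines "W \<equiv> \<lambda>S. insert ([], []) ({(k # p, \<pi> k # p) | k p. k < m \<and> k \<noteq> e} \<union>
      {(e # p, \<pi> e # q) | p q. (p, q) \<in> S})"
  shows "game (f e) (g (\<pi> e)) list_iso d S \<Longrightarrow> ([], []) \<in> S \<Longrightarrow>
    game (node m f) (node m g) list_iso d (W S)"
proof (induction d arbitrary: S)
  case 0
  have inj: "\<pi> k = \<pi> k' \<longleftrightarrow> k = k'" if "k < m" "k' < m" for k k'
    using bij that by (auto simp: bij_betw_def inj_on_def)
  have S: "(p = p' \<longleftrightarrow> q = q') \<and> (list_adj p p' \<longleftrightarrow> list_adj q q')"
    if "(p, q) \<in> S" "(p', q') \<in> S" for p q p' q'
    using 0(1) that unfolding game.simps list_iso_def by blast
  have root: "p = [] \<longleftrightarrow> q = []" if "(p, q) \<in> S" for p q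
    using S[OF that 0(2)] by blast
  have W: "P x y" if "(x, y) \<in> W S" "P [] []" "\<And>k p. k < m \<Longrightarrow> k \<noteq> e \<Longrightarrow> P (k # p) (\<pi> k # p)"
      "\<And>p q. (p, q) \<in> S \<Longrightarrow> P (e # p) (\<pi> e # q)" for P x y
    using that unfolding W_def by blast
  show ?case unfolding game.simps list_iso_def
  proof (intro allI impI)
    fix p q p' q' assume pq: "(p, q) \<in> W S" and pq': "(p', q') \<in> W S"
    show "(p = p' \<longleftrightarrow> q = q') \<and> (list_adj p p' \<longleftrightarrow> list_adj q q')"
    proof (rule W[OF pq], goal_cases)
      case 1
      show ?case by (rule W[OF pq']) (auto simp: root)
    next
      case (2 k r)
      show ?case by (rule W[OF pq']) (use 2 inj e in auto)
    next
      case (3 r s)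
      show ?case by (rule W[OF pq']) (use 3 S[OF 3] inj e root in auto)
    qed
  qed
next
  case (Suc d)
  have low: "game (node m f) (node m g) list_iso d (W S)"
    by (rule Suc.IH[OF game_Suc_imp[OF list_iso_subset _ Suc.prems(1)] Suc.prems(2)]) (use ne in blast)
  have refl: "game (node m f) (node m g) list_iso d (insert (x, y) (W S))" if "(x, y) \<in> W S" for x y
    using low that by (simp add: insert_absorb)
  have exc: "game (node m f) (node m g) list_iso d (insert (e # p, \<pi> e # q) (W S))"
    if "game (f e) (g (\<pi> e)) list_iso d (insert (p, q) S)" for p q
    by (rule game_subset[OF list_iso_subset Suc.IH[OF that]]) (use Suc.prems(2) in \<open>auto simp: W_def\<close>)
  have lt: "\<pi> k < m" if "k < m" for k using bij that by (auto simp: bij_betw_def)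
  show ?case unfolding game.simps
  proof (intro conjI ballI)
    fix x assume "x \<in> node m f"
    then show "\<exists>y\<in>node m g. game (node m f) (node m g) list_iso d (insert (x, y) (W S))"
    proof (cases rule: node_cases)
      case 1
      then show ?thesis using refl[of "[]" "[]"] by (intro bexI[of _ "[]"]) (auto simp: W_def)
    next
      case (2 k p)
      show ?thesis
      proof (cases "k = e")
        case True
        then obtain q where "q \<in> g (\<pi> e)" "game (f e) (g (\<pi> e)) list_iso d (insert (p, q) S)"
          using 2 Suc.prems(1) by auto
        then show ?thesis using exc[of p q] True 2 lt e by (intro bexI[of _ "\<pi> e # q"]) auto
      next
        case False
        then show ?thesis using refl[of "k # p" "\<pi> k # p"] 2 lt eq
          by (intro bexI[of _ "\<pi> k # p"]) (auto simp: W_def)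
      qed
    qed
  next
    fix y assume "y \<in> node m g"
    then show "\<exists>x\<in>node m f. game (node m f) (node m g) list_iso d (insert (x, y) (W S))"
    proof (cases rule: node_cases)
      case 1
      then show ?thesis using refl[of "[]" "[]"] by (intro bexI[of _ "[]"]) (auto simp: W_def)
    next
      case (2 c q)
      then have "c \<in> \<pi> ` {..<m}" using bij by (simp add: bij_betw_def)
      then obtain k where k: "k < m" "c = \<pi> k" by blast
      show ?thesis
      proof (cases "k = e")
        case True
        then obtain p where "p \<in> f e" "game (f e) (g (\<pi> e)) list_iso d (insert (p, q) S)"
          using 2 k Suc.prems(1) by auto
        then show ?thesis using exc[of p q] True 2 k by (intro bexI[of _ "e # p"]) auto
      next
        case False
        then show ?thesis using refl[of "k # q" "\<pi> k # q"] 2 k eq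
          by (intro bexI[of _ "k # q"]) (auto simp: W_def)
      qed
    qed
  qed
qed

lemma bij_betw_swap:
  assumes "bij_betw \<pi> A A" "a \<in> A" "b \<in> A"
  shows "bij_betw (\<pi>(a := \<pi> b, b := \<pi> a)) A A"
proof -
  have "inj_on (\<pi>(a := \<pi> b, b := \<pi> a)) A"
    using assms by (auto simp: bij_betw_def inj_on_def)
  moreover have "(\<pi>(a := \<pi> b, b := \<pi> a)) ` A = \<pi> ` A"
  proof
    show "(\<pi>(a := \<pi> b, b := \<pi> a)) ` A \<subseteq> \<pi> ` A" using assms by auto
    show "\<pi> ` A \<subseteq> (\<pi>(a := \<pi> b, b := \<pi> a)) ` A"
    proof
      fix y assume "y \<in> \<pi> ` A"
      then obtain x where "x \<in> A" "y = \<pi> x" by blast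
      then show "y \<in> (\<pi>(a := \<pi> b, b := \<pi> a)) ` A"
        using assms by (cases "x = a"; cases "x = b") (auto simp: image_iff)
    qed
  qed
  ultimately show ?thesis using assms(1) by (simp add: bij_betw_def)
qed

text \<open>As long as untouched copies of both types remain, Duplicator can answer a move in the
  exceptional pair of branches by re-pairing it with an untouched pair of branches of equal type.\<close>

lemma node_game_repair:
  fixes A B :: "nat list set"
  assumes AB: "game A B list_iso d {([], [])}" and A: "[] \<in> A"
  defines "V \<equiv> \<lambda>\<pi> K. insert ([], []) {(k # p, \<pi> k # p :: nat list) | k p. k \<in> K}"
  shows "bij_betw \<pi> {..<m} {..<m} \<Longrightarrow> e < m \<Longrightarrow> K \<subseteq> {..<m} \<Longrightarrow> e \<notin> K \<Longrightarrow> f e = A \<Longrightarrow> g (\<pi> e) = B \<Longrightarrow>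
    (\<And>k. k < m \<Longrightarrow> k \<noteq> e \<Longrightarrow> f k = g (\<pi> k)) \<Longrightarrow>
    j \<le> card {k \<in> {..<m} - K - {e}. f k = A} \<Longrightarrow> j \<le> card {k \<in> {..<m} - K - {e}. f k = B} \<Longrightarrow>
    game (node m f) (node m g) list_iso (j + d) (V \<pi> K)"
proof (induction j arbitrary: \<pi> K e)
  case 0
  let ?S = "{([], [])} :: (nat list \<times> nat list) set"
  \<comment> \<open>No spare copy is counted any more: the pairing is kept, and the exceptional pair
    of branches lasts for \<open>d\<close> rounds.\<close>
  have "game (node m f) (node m g) list_iso d (insert ([], []) ({(k # p, \<pi> k # p) | k p. k < m \<and> k \<noteq> e} \<union>
      {(e # p, \<pi> e # q) | p q. (p, q) \<in> ?S}))"
    by (rule node_game_exceptional) (use 0 AB A in auto)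
  then show ?case unfolding add_0
    by (rule game_subset[OF list_iso_subset]) (use 0 in \<open>auto simp: V_def\<close>)
next
  case (Suc j)
  note bij = Suc.prems(1) and e = Suc.prems(2) and K = Suc.prems(3) and eK = Suc.prems(4)
    and fe = Suc.prems(5) and ge = Suc.prems(6) and eq = Suc.prems(7)
  have lt: "\<pi> k < m" if "k < m" for k using bij that by (auto simp: bij_betw_def)
  let ?g = "\<lambda>R. game (node m f) (node m g) list_iso (j + d) R"
  have remove: "j \<le> card (X - {z})" if "Suc j \<le> card X" for X and z :: nat
    using that by (cases "z \<in> X") auto
  have nonempty: "\<exists>k. k \<in> X" if "Suc j \<le> card X" for X :: "nat set"
    using that by (cases "X = {}") auto
  \<comment> \<open>A move in an equal pair freezes that pair, which uses up at most one spare
    copy.\<close>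
  have plain: "?g (insert (k # p, \<pi> k # p) (V \<pi> K))" if k: "k < m" "k \<noteq> e" for k p
  proof -
    have sub: "{i \<in> {..<m} - insert k K - {e}. f i = X} = {i \<in> {..<m} - K - {e}. f i = X} - {k}" for X
      by auto
    have "?g (V \<pi> (insert k K))"
    proof (rule Suc.IH[OF bij e _ _ fe ge eq])
      show "j \<le> card {i \<in> {..<m} - insert k K - {e}. f i = A}"
        "j \<le> card {i \<in> {..<m} - insert k K - {e}. f i = B}"
        unfolding sub using remove Suc.prems(8,9) by blast+
    qed (use k K eK in auto)
    then show ?thesis
      by (rule game_subset[OF list_iso_subset]) (auto simp: V_def)
  qed
  have low: "?g (V \<pi> K)"
    by (rule Suc.IH[OF bij e K eK fe ge eq]) (use Suc.prems(8,9) in auto)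
  \<comment> \<open>A move in the left exceptional branch \<open>e\<close>: it receives the partner
    of a spare \<open>A\<close>-branch \<open>k\<close>. Now \<open>k\<close> is exceptional,
    opposite \<open>\<pi> e\<close>.\<close>
  have left: "\<exists>y\<in>node m g. ?g (insert (e # p, y) (V \<pi> K))" if p: "p \<in> A" for p
  proof -
    obtain k where k: "k < m" "k \<notin> K" "k \<noteq> e" "f k = A"
      using nonempty[OF Suc.prems(8)] by auto
    define \<pi>' where "\<pi>' = \<pi>(e := \<pi> k, k := \<pi> e)"
    have sub: "{i \<in> {..<m} - insert e K - {k}. f i = X} = {i \<in> {..<m} - K - {e}. f i = X} - {k}" for X
      by auto
    have "?g (V \<pi>' (insert e K))"
    proof (rule Suc.IH[of _ k])
      show "bij_betw \<pi>' {..<m} {..<m}" unfolding \<pi>'_def using bij_betw_swap[OF bij] e k by simp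
      show "f i = g (\<pi>' i)" if "i < m" "i \<noteq> k" for i
        using that eq k fe by (auto simp: \<pi>'_def)
      show "j \<le> card {i \<in> {..<m} - insert e K - {k}. f i = A}"
        "j \<le> card {i \<in> {..<m} - insert e K - {k}. f i = B}"
        unfolding sub using remove Suc.prems(8,9) by blast+
    qed (use k e K eK ge in \<open>auto simp: \<pi>'_def\<close>)
    then have "?g (insert (e # p, \<pi> k # p) (V \<pi> K))"
      by (rule game_subset[OF list_iso_subset]) (use k eK in \<open>auto simp: V_def \<pi>'_def\<close>)
    then show ?thesis using p k eq[of k] lt by (intro bexI[of _ "\<pi> k # p"]) auto
  qed
  \<comment> \<open>A move in the right exceptional branch: it receives a spare
    \<open>B\<close>-branch \<open>k\<close> as partner. \<open>e\<close> stays exceptional, now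
    opposite \<open>\<pi> k\<close>.\<close>
  have right: "\<exists>x\<in>node m f. ?g (insert (x, \<pi> e # q) (V \<pi> K))" if q: "q \<in> B" for q
  proof -
    obtain k where k: "k < m" "k \<notin> K" "k \<noteq> e" "f k = B"
      using nonempty[OF Suc.prems(9)] by auto
    define \<pi>' where "\<pi>' = \<pi>(e := \<pi> k, k := \<pi> e)"
    have sub: "{i \<in> {..<m} - insert k K - {e}. f i = X} = {i \<in> {..<m} - K - {e}. f i = X} - {k}" for X
      by auto
    have "?g (V \<pi>' (insert k K))"
    proof (rule Suc.IH[of _ e])
      show "bij_betw \<pi>' {..<m} {..<m}" unfolding \<pi>'_def using bij_betw_swap[OF bij] e k by simp
      show "f i = g (\<pi>' i)" if "i < m" "i \<noteq> e" for i
        using that eq k ge by (auto simp: \<pi>'_def)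
      show "j \<le> card {i \<in> {..<m} - insert k K - {e}. f i = A}"
        "j \<le> card {i \<in> {..<m} - insert k K - {e}. f i = B}"
        unfolding sub using remove Suc.prems(8,9) by blast+
      show "g (\<pi>' e) = B" using k eq by (simp add: \<pi>'_def)
    qed (use k e K eK fe in auto)
    then have "?g (insert (k # q, \<pi> e # q) (V \<pi> K))"
      by (rule game_subset[OF list_iso_subset]) (use k eK in \<open>auto simp: V_def \<pi>'_def\<close>)
    then show ?thesis using q k by (intro bexI[of _ "k # q"]) auto
  qed
  have root: "?g (insert ([], []) (V \<pi> K))" using low by (simp add: V_def insert_absorb)
  show ?case unfolding add_Suc game.simps
  proof (intro conjI ballI)
    fix x assume "x \<in> node m f"
    then show "\<exists>y\<in>node m g. ?g (insert (x, y) (V \<pi> K))"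
    proof (cases rule: node_cases)
      case 1
      then show ?thesis using root by (intro bexI[of _ "[]"]) auto
    next
      case (2 k p)
      then show ?thesis using left[of p] plain[of k p] fe eq[of k] lt
        by (cases "k = e") (auto intro!: bexI[of _ "\<pi> k # p"])
    qed
  next
    fix y assume "y \<in> node m g"
    then show "\<exists>x\<in>node m f. ?g (insert (x, y) (V \<pi> K))"
    proof (cases rule: node_cases)
      case 1
      then show ?thesis using root by (intro bexI[of _ "[]"]) auto
    next
      case (2 c q)
      then have "c \<in> \<pi> ` {..<m}" using bij by (simp add: bij_betw_def)
      then obtain k where k: "k < m" "c = \<pi> k" by blast
      then show ?thesis using right[of q] plain[of k q] ge eq[of k] 2
        by (cases "k = e") (auto intro!: bexI[of _ "k # q"])
    qed
  qed
qed

section \<open>The two recursive trees: game length and order\<close>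

primrec hard_tree :: "nat \<Rightarrow> nat \<Rightarrow> bool \<Rightarrow> nat list set" where
  "hard_tree h 0 b = (if b then {[]} else {[], [0]})"
| "hard_tree h (Suc i) b = node (2 * h + 1) (\<lambda>k. hard_tree h i (if b then k \<le> h else k < h))"

lemma Nil_in_hard_tree [simp]: "[] \<in> hard_tree h i b"
  by (cases i) auto

text \<open>On the next level the two trees have equal branches except at the middle index
  \<open>h\<close>, and \<open>h\<close> further copies of either type surround it. So each level
  adds \<open>h\<close> rounds.\<close>

lemma hard_tree_game: "game (hard_tree h i True) (hard_tree h i False) list_iso (h * i) {([], [])}"
proof (induction i)
  case 0
  then show ?case by (simp add: list_iso_def)
next
  case (Suc i)
  let ?m = "2 * h + 1" and ?A = "hard_tree h i True" and ?B = "hard_tree h i False"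
  let ?f = "\<lambda>k. hard_tree h i (k \<le> h)" and ?g = "\<lambda>k. hard_tree h i (k < h)"
  have "game (node ?m ?f) (node ?m ?g) list_iso (h + h * i)
     (insert ([], []) {(k # p, id k # p) | k p. k \<in> {}})"
  proof (rule node_game_repair[OF Suc.IH, where e = h])
    show "bij_betw id {..<?m} {..<?m}" by simp
    have "card {..<h} \<le> card {k \<in> {..<?m} - {} - {h}. ?f k = ?A}" by (rule card_mono) auto
    then show "h \<le> card {k \<in> {..<?m} - {} - {h}. ?f k = ?A}" by simp
    have "card {h<..<?m} \<le> card {k \<in> {..<?m} - {} - {h}. ?f k = ?B}" by (rule card_mono) auto
    then show "h \<le> card {k \<in> {..<?m} - {} - {h}. ?f k = ?B}" by simp
    show "?f k = ?g (id k)" if "k \<noteq> h" for k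
    proof -
      have "k \<le> h \<longleftrightarrow> k < h" using that by auto
      then show ?thesis by simp
    qed
  qed auto
  then show ?case by simp
qed

lemma card_node:
  assumes "\<And>k. finite (f k)"
  shows "finite (node m f)" "card (node m f) = Suc (\<Sum>k<m. card (f k))"
proof -
  have eq: "node m f = insert [] (\<Union>k\<in>{..<m}. (#) k ` f k)" by (auto simp: node_def)
  show "finite (node m f)" unfolding eq using assms by simp
  have "card (\<Union>k\<in>{..<m}. (#) k ` f k) = (\<Sum>k<m. card ((#) k ` f k))"
    by (rule card_UN_disjoint) (use assms in auto)
  also have "\<dots> = (\<Sum>k<m. card (f k))" by (intro sum.cong refl card_image) auto
  finally show "card (node m f) = Suc (\<Sum>k<m. card (f k))"
    unfolding eq using assms by (subst card_insert_disjoint) auto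
qed

lemma finite_hard_tree [simp]: "finite (hard_tree h i b)"
  by (induction i arbitrary: b) (auto intro: card_node)

text \<open>The order certifies non-isomorphism: the trees differ in one branch, so the single extra
  vertex of level 0 is passed on through all levels.\<close>

lemma card_hard_tree_False: "card (hard_tree h i False) = Suc (card (hard_tree h i True))"
proof (induction i)
  case (Suc i)
  let ?c = "\<lambda>b. card (hard_tree h i b)"
  have "(\<Sum>k<2 * h + 1. ?c (k \<le> h)) = (\<Sum>k\<in>{..<2 * h + 1} - {h}. ?c (k < h)) + ?c True"
    by (subst sum.remove[of _ h]) (auto intro!: sum.cong arg_cong[where f = ?c])
  moreover have "(\<Sum>k<2 * h + 1. ?c (k < h)) = (\<Sum>k\<in>{..<2 * h + 1} - {h}. ?c (k < h)) + ?c False"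
    by (subst sum.remove[of _ h]) auto
  ultimately show ?case using Suc by (simp add: card_node)
qed simp

lemma card_hard_tree_le: "card (hard_tree h i b) \<le> 2 * (2 * h + 2) ^ i"
proof (induction i arbitrary: b)
  case (Suc i)
  let ?S = "\<Sum>k<2 * h + 1. card (hard_tree h i (if b then k \<le> h else k < h))"
  have card: "card (hard_tree h (Suc i) b) = Suc ?S"
    unfolding hard_tree.simps by (rule card_node) simp
  have "?S \<le> (\<Sum>k<2 * h + 1. 2 * (2 * h + 2) ^ i)"
    by (intro sum_mono Suc)
  then have sum: "?S \<le> (2 * h + 1) * (2 * (2 * h + 2) ^ i)" by simp
  have "1 \<le> (2 * h + 2) ^ i" by simp
  then have "Suc ((2 * h + 1) * (2 * (2 * h + 2) ^ i)) \<le> 2 * ((2 * h + 2) * (2 * h + 2) ^ i)"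
    by (simp only: distrib_right) simp
  then show ?case unfolding card power_Suc using sum by linarith
qed auto

lemma hard_tree_snoc: "p @ [k] \<in> hard_tree h i b \<Longrightarrow> p \<in> hard_tree h i b \<and> k < 2 * h + 1"
proof (induction i arbitrary: p b)
  case (Suc i)
  then show ?case by (cases p) auto
qed (auto split: if_splits simp: Cons_eq_append_conv)

section \<open>From sets of lists to graphs on natural numbers\<close>

definition list_graph :: "nat list set \<Rightarrow> colored_graph" where
  "list_graph V = \<lparr>verts = list_encode ` V,
     adj = (\<lambda>u v. list_decode u \<in> V \<and> list_decode v \<in> V \<and> list_adj (list_decode u) (list_decode v)),
     color = (\<lambda>_. {})\<rparr>"

lemma list_graph_simps [simp]:
  "verts (list_graph V) = list_encode ` V"
  "adj (list_graph V) u v \<longleftrightarrow>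
     list_decode u \<in> V \<and> list_decode v \<in> V \<and> list_adj (list_decode u) (list_decode v)"
  by (simp_all add: list_graph_def)

lemma list_encode_in_image [simp]: "list_encode p \<in> list_encode ` V \<longleftrightarrow> p \<in> V"
  by (auto simp: list_encode_eq)

lemma bf_list_graph:
  "game V W list_iso d R \<Longrightarrow> R \<subseteq> V \<times> W \<Longrightarrow>
    bf {} (list_graph V) (list_graph W) d (map_prod list_encode list_encode ` R)"
proof (induction d arbitrary: R)
  case 0
  have *: "(p = p' \<longleftrightarrow> q = q') \<and> (list_adj p p' \<longleftrightarrow> list_adj q q')" "p \<in> V" "p' \<in> V" "q \<in> W" "q' \<in> W"
    if "(p, q) \<in> R" "(p', q') \<in> R" for p q p' q'
    using 0 that unfolding game.simps list_iso_def by blast+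
  show ?case unfolding game.simps partial_iso_def
  proof (intro allI impI conjI)
    fix u u' v v'
    assume "(u, u') \<in> map_prod list_encode list_encode ` R" "(v, v') \<in> map_prod list_encode list_encode ` R"
    then obtain p q p' q' where pq: "(p, q) \<in> R" "(p', q') \<in> R" and eq: "u = list_encode p"
      "u' = list_encode q" "v = list_encode p'" "v' = list_encode q'" by auto
    from *[OF pq] show "u = v \<longleftrightarrow> u' = v'" "adj (list_graph V) u v \<longleftrightarrow> adj (list_graph W) u' v'"
      unfolding eq by (simp_all add: list_encode_eq)
  qed auto
next
  case (Suc d)
  have step: "bf {} (list_graph V) (list_graph W) d
      (insert (list_encode p, list_encode q) (map_prod list_encode list_encode ` R))"
    if "game V W list_iso d (insert (p, q) R)" "p \<in> V" "q \<in> W" for p q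
    using Suc.IH[OF that(1)] that(2,3) Suc.prems(2) by simp
  show ?case using Suc.prems(1) step unfolding game.simps list_graph_simps by blast
qed

lemma list_graph_tree:
  assumes "finite V" "[] \<in> V" and closed: "\<And>p k. p @ [k] \<in> V \<Longrightarrow> p \<in> V"
  shows "is_colored_tree {} (list_graph V)"
proof -
  let ?G = "list_graph V"
  have sym: "list_adj p q \<longleftrightarrow> list_adj q p" for p q by (auto simp: list_adj_def)
  have irr: "\<not> list_adj p p" for p by (auto simp: list_adj_def)
  have "is_colored_graph {} ?G" unfolding is_colored_graph_def
  proof (intro conjI allI impI)
    fix u v assume "adj ?G u v"
    then have "list_encode (list_decode u) \<in> verts ?G" "list_encode (list_decode v) \<in> verts ?G"
      unfolding list_graph_simps by blast+
    then show "u \<in> verts ?G" "v \<in> verts ?G" by simp_all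
    show "adj ?G v u" using \<open>adj ?G u v\<close> sym by simp
  qed (use assms irr in auto)
  moreover have "connected_graph ?G"
  proof -
    have sy: "symp (adj ?G)\<^sup>*\<^sup>*"
      by (rule symp_rtranclp) (auto simp: symp_def sym)
    have root: "(adj ?G)\<^sup>*\<^sup>* (list_encode p) (list_encode [])" if "p \<in> V" for p
      using that
    proof (induction p rule: rev_induct)
      case (snoc k p)
      have "adj ?G (list_encode (p @ [k])) (list_encode p)"
        using snoc.prems closed by (auto simp: list_adj_def)
      with snoc.IH[OF closed[OF snoc.prems]] show ?case by (rule converse_rtranclp_into_rtranclp[rotated])
    qed simp
    show ?thesis unfolding connected_graph_def
    proof (intro ballI)
      fix u v assume "u \<in> verts ?G" "v \<in> verts ?G"
      then obtain p q where pq: "p \<in> V" "q \<in> V" "u = list_encode p" "v = list_encode q" by auto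
      with root[of q] sy have "(adj ?G)\<^sup>*\<^sup>* (list_encode []) v" by (blast dest: sympD)
      with root[of p] pq show "(adj ?G)\<^sup>*\<^sup>* u v" by (metis rtranclp_trans)
    qed
  qed
  moreover have "\<not> is_cycle ?G c" for c
  proof
    assume c: "is_cycle ?G c"
    let ?n = "length c" and ?l = "\<lambda>i. length (list_decode (c ! i))"
    have n: "3 \<le> ?n" "distinct c"
      and adj: "\<And>i. i < ?n \<Longrightarrow> list_adj (list_decode (c ! i)) (list_decode (c ! (Suc i mod ?n)))"
      using c unfolding is_cycle_def list_graph_simps by blast+
    \<comment> \<open>A longest list on the cycle. Neither cyclic neighbour is longer, so both are
      its parent; but they are distinct, as the cycle has at least three vertices.\<close>
    obtain i where i: "i < ?n" "\<And>j. j < ?n \<Longrightarrow> ?l j \<le> ?l i"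
    proof -
      have "\<exists>i. i \<in> {..<?n} \<and> (\<forall>j. j \<in> {..<?n} \<longrightarrow> ?l j \<le> ?l i)"
        by (rule ex_has_greatest_nat[of _ 0 _ "Suc (Max (?l ` {..<?n}))"])
          (use n in \<open>auto simp: less_Suc_eq_le\<close>)
      then show thesis using that by auto
    qed
    have parent: "list_decode (c ! j) = butlast (list_decode (c ! i))"
      if "j < ?n" "list_adj (list_decode (c ! i)) (list_decode (c ! j))" for j
      using i(2)[OF that(1)] that(2) by (auto simp: list_adj_def)
    define j k where "j = (if Suc i = ?n then 0 else Suc i)" and "k = (if i = 0 then ?n - 1 else i - 1)"
    have jk: "j < ?n" "k < ?n" "j \<noteq> k" "Suc i mod ?n = j" "Suc k mod ?n = i"
      using i n by (auto simp: j_def k_def split: if_splits)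
    have "list_decode (c ! j) = list_decode (c ! k)"
      using parent[of j] parent[of k] adj[OF i(1)] adj[OF jk(2)] jk sym by metis
    then have "c ! j = c ! k" by (metis list_decode_inverse)
    then show False using n(2) jk nth_eq_iff_index_eq by blast
  qed
  ultimately show ?thesis by (simp add: is_colored_tree_def)
qed

lemma indistinguishable_trees:
  assumes "2 * h + 2 \<le> l" "2 * (2 * h + 2) ^ i \<le> n"
  shows "\<exists>T \<in> trees_upto {} n l. \<exists>H. is_colored_graph {} H \<and> \<not> isomorphic {} T H \<and> bf {} T H (h * i) {}"
proof (intro bexI exI conjI)
  let ?A = "hard_tree h i True" and ?B = "hard_tree h i False"
  have card: "card (list_encode ` V) = card V" for V
    by (intro card_image inj_on_subset[OF inj_list_encode]) auto
  have tree: "is_colored_tree {} (list_graph (hard_tree h i b))" for b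
    using hard_tree_snoc by (intro list_graph_tree) auto
  then show "is_colored_graph {} (list_graph ?B)" by (simp add: is_colored_tree_def)
  show "\<not> isomorphic {} (list_graph ?A) (list_graph ?B)"
    using card_hard_tree_False[of h i] card by (auto simp: isomorphic_def dest!: bij_betw_same_card)
  have "bf {} (list_graph ?A) (list_graph ?B) (h * i) (map_prod list_encode list_encode ` {([], [])})"
    by (rule bf_list_graph[OF hard_tree_game]) auto
  then show "bf {} (list_graph ?A) (list_graph ?B) (h * i) {}" by (rule bf_subset) simp
  show "list_graph ?A \<in> trees_upto {} n l"
    unfolding trees_upto_def
  proof (intro CollectI conjI ballI)
    show "is_colored_tree {} (list_graph ?A)" by (rule tree)
    show "card (verts (list_graph ?A)) \<le> n"
      using card_hard_tree_le[of h i True] assms(2) by (simp add: card)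
    fix v assume "v \<in> verts (list_graph ?A)"
    then obtain p where p: "v = list_encode p" by auto
    \<comment> \<open>Parent and children; at the root \<open>butlast p\<close> is \<open>p\<close>
      itself, which only enlarges the set.\<close>
    let ?N = "insert (butlast p) ((\<lambda>k. p @ [k]) ` {..<2 * h + 1})"
    have "degree (list_graph ?A) v \<le> card (list_encode ` ?N)"
      unfolding degree_def
    proof (rule card_mono)
      show "{w \<in> verts (list_graph ?A). adj (list_graph ?A) v w} \<subseteq> list_encode ` ?N"
      proof
        fix w assume w: "w \<in> {w \<in> verts (list_graph ?A). adj (list_graph ?A) v w}"
        then obtain q where q: "w = list_encode q" "q \<in> ?A" by auto
        then have "list_adj p q" using w p by simp
        then have "q \<in> ?N" unfolding list_adj_def
        proof (elim exE disjE)
          fix k assume "q = p @ [k]"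
          then show ?thesis using q(2) hard_tree_snoc[of p k] by auto
        qed simp
        then show "w \<in> list_encode ` ?N" unfolding q(1) by (rule imageI)
      qed
    qed simp
    also have "\<dots> \<le> Suc (card ((\<lambda>k. p @ [k]) ` {..<2 * h + 1}))"
      unfolding card by (rule card_insert_le_m1) simp_all
    also have "\<dots> \<le> 2 * h + 2" using card_image_le[of "{..<2 * h + 1}" "\<lambda>k. p @ [k]"] by simp
    finally show "degree (list_graph ?A) v \<le> l" using assms(1) by simp
  qed
qed

subsection \<open>Components of a graph with some vertices removed\<close>

definition edges :: "colored_graph \<Rightarrow> nat set \<Rightarrow> (nat \<times> nat) set" where
  "edges G P = {(a, b). adj G a b \<and> a \<notin> P \<and> b \<notin> P}"

definition component :: "colored_graph \<Rightarrow> nat set \<Rightarrow> nat \<Rightarrow> nat set" where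
  "component G P r = {x. (r, x) \<in> (edges G P)\<^sup>*}"

definition nbrs :: "colored_graph \<Rightarrow> nat set \<Rightarrow> nat \<Rightarrow> nat set" where
  "nbrs G P v = {u. adj G v u \<and> u \<notin> P}"

text \<open>Acyclicity in a form suited to the game: a violation consists of three vertices and one
  walk, and the condition cuts a component into disjoint branches around any vertex. Connectedness
  is treated separately.\<close>

definition treelike :: "nat set \<Rightarrow> colored_graph \<Rightarrow> bool" where
  "treelike I G \<longleftrightarrow> is_colored_graph I G \<and>
     (\<forall>x y z. adj G x y \<longrightarrow> adj G x z \<longrightarrow> y \<noteq> z \<longrightarrow> (y, z) \<notin> (edges G {x})\<^sup>*)"

lemma colored_graphD:
  assumes "is_colored_graph I G"
  shows "finite (verts G)" "verts G \<noteq> {}" "adj G u v \<Longrightarrow> u \<in> verts G" "adj G u v \<Longrightarrow> v \<in> verts G"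
    "adj G u v \<Longrightarrow> adj G v u" "\<not> adj G v v"
  using assms unfolding is_colored_graph_def by blast+

lemma treelike_graph: "treelike I G \<Longrightarrow> is_colored_graph I G"
  by (simp add: treelike_def)

lemma treelikeD:
  "treelike I G \<Longrightarrow> adj G x y \<Longrightarrow> adj G x z \<Longrightarrow> y \<noteq> z \<Longrightarrow> (y, z) \<notin> (edges G {x})\<^sup>*"
  unfolding treelike_def by blast

lemma edges_antimono: "P \<subseteq> Q \<Longrightarrow> edges G Q \<subseteq> edges G P"
  by (auto simp: edges_def)

lemma component_antimono: "P \<subseteq> Q \<Longrightarrow> component G Q r \<subseteq> component G P r"
  unfolding component_def using rtrancl_mono[OF edges_antimono] by blast

lemma component_self [simp]: "r \<in> component G P r"
  by (simp add: component_def)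

lemma component_step: "x \<in> component G P r \<Longrightarrow> adj G x y \<Longrightarrow> x \<notin> P \<Longrightarrow> y \<notin> P \<Longrightarrow> y \<in> component G P r"
  unfolding component_def by (auto simp: edges_def intro: rtrancl_into_rtrancl)

lemma component_notin: "x \<in> component G P r \<Longrightarrow> r \<notin> P \<Longrightarrow> x \<notin> P"
  unfolding component_def by (auto simp: edges_def elim: rtranclE)

lemma component_subset_verts: "is_colored_graph I G \<Longrightarrow> r \<in> verts G \<Longrightarrow> component G P r \<subseteq> verts G"
  unfolding component_def by (auto simp: edges_def dest: colored_graphD(4) elim: rtranclE)

lemma finite_component: "is_colored_graph I G \<Longrightarrow> r \<in> verts G \<Longrightarrow> finite (component G P r)"
  using component_subset_verts colored_graphD(1) finite_subset by metis

lemma card_component_pos: "is_colored_graph I G \<Longrightarrow> r \<in> verts G \<Longrightarrow> card (component G P r) \<ge> 1"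
  using finite_component[of I G r P] by (metis One_nat_def Suc_leI card_gt_0_iff component_self empty_iff)

lemma component_sym: "is_colored_graph I G \<Longrightarrow> x \<in> component G P r \<Longrightarrow> r \<in> component G P x"
proof -
  assume G: "is_colored_graph I G" and x: "x \<in> component G P r"
  have "sym (edges G P)" unfolding sym_def edges_def using colored_graphD(5)[OF G] by blast
  then show ?thesis using x unfolding component_def by (auto dest: sym_rtrancl symD)
qed

lemma component_trans: "x \<in> component G P r \<Longrightarrow> y \<in> component G P x \<Longrightarrow> y \<in> component G P r"
  unfolding component_def by (auto intro: rtrancl_trans)

lemma component_eq: "is_colored_graph I G \<Longrightarrow> x \<in> component G P r \<Longrightarrow> component G P x = component G P r"
  using component_sym component_trans by blast

text \<open>Cut the walk from \<open>v\<close> after its last visit to \<open>v\<close>; the rest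
  runs inside one branch.\<close>

lemma component_decomp:
  assumes "is_colored_graph I G" "x \<in> component G P v"
  shows "x = v \<or> (\<exists>u\<in>nbrs G P v. x \<in> component G (insert v P) u)"
  using assms(2) unfolding component_def mem_Collect_eq
proof (induction rule: rtrancl_induct)
  case (step y z)
  then have yz: "adj G y z" "y \<notin> P" "z \<notin> P" by (auto simp: edges_def)
  show ?case
  proof (cases "z = v")
    case False
    show ?thesis
    proof (cases "y = v")
      case True
      then show ?thesis using yz by (auto simp: nbrs_def)
    next
      case False
      then obtain u where u: "u \<in> nbrs G P v" "(u, y) \<in> (edges G (insert v P))\<^sup>*"
        using step.IH by blast
      have "(y, z) \<in> edges G (insert v P)" using yz \<open>z \<noteq> v\<close> False by (simp add: edges_def)
      then show ?thesis using u by (meson rtrancl_into_rtrancl)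
    qed
  qed simp
qed simp

section \<open>Branches at a vertex, and centroids\<close>

lemma nbrs_notin: "is_colored_graph I G \<Longrightarrow> u \<in> nbrs G P v \<Longrightarrow> u \<notin> insert v P"
  using colored_graphD(6) by (auto simp: nbrs_def)

lemma nbrs_verts: "is_colored_graph I G \<Longrightarrow> nbrs G P v \<subseteq> verts G"
  using colored_graphD(4) by (auto simp: nbrs_def)

lemma finite_nbrs: "is_colored_graph I G \<Longrightarrow> finite (nbrs G P v)"
  using nbrs_verts colored_graphD(1) finite_subset by metis

lemma card_nbrs_le: "is_colored_graph I G \<Longrightarrow> card (nbrs G P v) \<le> degree G v"
  unfolding degree_def nbrs_def
  by (intro card_mono) (auto simp: colored_graphD(1) dest: colored_graphD(4))

lemma nbrs_in_component: "v \<notin> P \<Longrightarrow> u \<in> nbrs G P v \<Longrightarrow> u \<in> component G P v"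
  using component_step[of v G P v u] by (simp add: nbrs_def)

lemma branch_subset:
  assumes "is_colored_graph I G" "v \<notin> P" "u \<in> nbrs G P v"
  shows "component G (insert v P) u \<subseteq> component G P v - {v}"
proof -
  have "component G (insert v P) u \<subseteq> component G P v"
    using component_antimono[of P "insert v P" G u] component_eq[OF assms(1) nbrs_in_component[OF assms(2,3)]] by blast
  moreover have "v \<notin> component G (insert v P) u"
    using component_notin[of v G "insert v P" u] nbrs_notin[OF assms(1,3)] by blast
  ultimately show ?thesis by blast
qed

lemma branch_disjoint:
  assumes "treelike I G" "u \<in> nbrs G P v" "w \<in> nbrs G P v" "u \<noteq> w"
  shows "component G (insert v P) u \<inter> component G (insert v P) w = {}"
proof (rule ccontr)
  assume "\<not> ?thesis"
  then obtain x where "x \<in> component G (insert v P) u" "x \<in> component G (insert v P) w" by blast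
  then have "w \<in> component G (insert v P) u"
    using component_sym[OF treelike_graph[OF assms(1)]] component_trans by blast
  then have "w \<in> component G {v} u" using component_antimono[of "{v}" "insert v P" G u] by blast
  then show False using treelikeD[OF assms(1), of v u w] assms(2-4) by (simp add: component_def nbrs_def)
qed

lemma sum_card_branches:
  assumes G: "treelike I G" and v: "v \<notin> P" "v \<in> verts G" and U: "U \<subseteq> nbrs G P v"
  shows "(\<Sum>u\<in>U. card (component G (insert v P) u)) \<le> card (component G P v)"
proof -
  note graph = treelike_graph[OF G]
  have "(\<Sum>u\<in>U. card (component G (insert v P) u)) = card (\<Union>u\<in>U. component G (insert v P) u)"
  proof (rule card_UN_disjoint[symmetric])
    show "finite U" using U finite_nbrs[OF graph] finite_subset by metis
    show "\<forall>u\<in>U. finite (component G (insert v P) u)"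
      using U nbrs_verts[OF graph] finite_component[OF graph] by blast
    show "\<forall>u\<in>U. \<forall>w\<in>U. u \<noteq> w \<longrightarrow> component G (insert v P) u \<inter> component G (insert v P) w = {}"
      using branch_disjoint[OF G] U by blast
  qed
  also have "\<dots> \<le> card (component G P v)"
    using branch_subset[OF graph v(1)] U by (intro card_mono finite_component[OF graph v(2)]) blast
  finally show ?thesis .
qed

text \<open>A walk from \<open>w\<close> that avoids \<open>u\<close> cannot reach \<open>v\<close>,
  as \<open>v\<close> and \<open>w\<close> are distinct neighbours of \<open>u\<close>; so it stays
  in the branch of \<open>u\<close> seen from \<open>v\<close>. Strictness is due to
  \<open>u\<close> itself.\<close>

lemma branch_descend:
  assumes G: "treelike I G" and v: "v \<notin> P" and u: "u \<in> nbrs G P v" and w: "w \<in> nbrs G P u" "w \<noteq> v"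
  shows "component G (insert u P) w \<subset> component G (insert v P) u"
proof -
  note graph = treelike_graph[OF G]
  have adj: "adj G u w" "adj G u v" using u w colored_graphD(5)[OF graph] by (auto simp: nbrs_def)
  have "x \<in> component G (insert v P) u" if "(w, x) \<in> (edges G (insert u P))\<^sup>*" for x
    using that
  proof (induction rule: rtrancl_induct)
    case base
    show ?case using component_step[of u G "insert v P" u w] w adj nbrs_notin[OF graph u] nbrs_notin[OF graph w(1)]
      by auto
  next
    case (step y z)
    have "(w, z) \<in> (edges G (insert u P))\<^sup>*" using step.hyps by (rule rtrancl_into_rtrancl)
    then have "(w, z) \<in> (edges G {u})\<^sup>*" using rtrancl_mono[OF edges_antimono[of "{u}" "insert u P"]] by blast
    then have "z \<noteq> v" using treelikeD[OF G adj] w by blast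
    moreover have "y \<notin> insert v P" using component_notin[OF step.IH] nbrs_notin[OF graph u] by blast
    ultimately show ?case using component_step[OF step.IH, of z] step.hyps by (auto simp: edges_def)
  qed
  then have "component G (insert u P) w \<subseteq> component G (insert v P) u" by (auto simp: component_def)
  moreover have "u \<notin> component G (insert u P) w"
    using component_notin[of u G "insert u P" w] nbrs_notin[OF graph w(1)] by blast
  ultimately show ?thesis using component_self[of u G "insert v P"] by blast
qed

lemma opposite_branches_disjoint:
  assumes G: "treelike I G" and v: "v \<notin> P" and u: "u \<in> nbrs G P v"
  shows "component G (insert u P) v \<inter> component G (insert v P) u = {}"
proof (rule ccontr)
  note graph = treelike_graph[OF G]
  assume "\<not> ?thesis"
  then obtain x where x: "x \<in> component G (insert u P) v" "x \<in> component G (insert v P) u" by blast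
  have adj: "adj G u v" using u colored_graphD(5)[OF graph] by (auto simp: nbrs_def)
  from component_decomp[OF graph x(2)] show False
  proof
    assume "x = u"
    then show False using component_notin[OF x(1)] v nbrs_notin[OF graph u] by blast
  next
    assume "\<exists>w\<in>nbrs G (insert v P) u. x \<in> component G (insert u (insert v P)) w"
    then obtain w where w: "w \<in> nbrs G (insert v P) u" "x \<in> component G (insert u (insert v P)) w" by blast
    have "x \<in> component G {u} w" "x \<in> component G {u} v"
      using w(2) x(1) component_antimono[of "{u}" "insert u (insert v P)"] component_antimono[of "{u}" "insert u P"]
      by blast+
    then have "v \<in> component G {u} w" using component_sym[OF graph] component_trans by blast
    then show False using treelikeD[OF G, of u w v] w(1) adj by (auto simp: nbrs_def component_def)
  qed
qed

text \<open>Otherwise every vertex has a branch of more than half the size. Take a smallest such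
  branch, from \<open>v\<close> to \<open>u\<close>, and a heavy branch of \<open>u\<close>. If it
  points back to \<open>v\<close>, the two are disjoint and too large together; if not, it is
  strictly smaller than the first.\<close>

lemma centroid_exists:
  assumes G: "treelike I G" and r: "r \<notin> P" "r \<in> verts G"
  shows "\<exists>v\<in>component G P r. \<forall>u\<in>nbrs G P v. 2 * card (component G (insert v P) u) \<le> card (component G P r)"
proof (rule ccontr)
  note graph = treelike_graph[OF G]
  let ?C = "component G P r"
  let ?h = "\<lambda>(v, u). v \<in> ?C \<and> u \<in> nbrs G P v \<and> card ?C < 2 * card (component G (insert v P) u)"
  let ?m = "\<lambda>(v, u). card (component G (insert v P) u)"
  assume no: "\<not> ?thesis"
  have heavy: "\<exists>u. ?h (v, u)" if v: "v \<in> ?C" for v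
  proof -
    obtain u where "u \<in> nbrs G P v" "\<not> 2 * card (component G (insert v P) u) \<le> card ?C" using no v by blast
    then show ?thesis using v by (intro exI[of _ u]) simp
  qed
  from heavy[OF component_self] obtain z where "?h z" by blast
  then have "\<exists>p. ?h p \<and> (\<forall>y. ?h y \<longrightarrow> ?m p \<le> ?m y)" by (rule ex_has_least_nat)
  then obtain p where p: "?h p" and least: "\<And>y. ?h y \<Longrightarrow> ?m p \<le> ?m y" by blast
  obtain v u where "p = (v, u)" by (cases p)
  with p least have vu: "?h (v, u)" and minimal: "\<And>y. ?h y \<Longrightarrow> card (component G (insert v P) u) \<le> ?m y"
    by simp_all
  have v: "v \<in> ?C" "v \<notin> P" "u \<in> nbrs G P v" using vu component_notin r by auto
  have "u \<in> ?C" using nbrs_in_component[OF v(2,3)] component_trans[OF v(1)] by blast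
  from heavy[OF this] obtain w where w: "?h (u, w)" by blast
  have fin: "finite ?C" using finite_component[OF graph r(2)] .
  have u: "u \<notin> P" using component_notin[OF \<open>u \<in> ?C\<close> r(1)] .
  have sub: "component G (insert v P) u \<subseteq> ?C" "component G (insert u P) w \<subseteq> ?C"
    using branch_subset[OF graph v(2,3)] branch_subset[OF graph u, of w] w
      component_eq[OF graph v(1)] component_eq[OF graph \<open>u \<in> ?C\<close>] by auto
  show False
  proof (cases "w = v")
    case True
    have "card (component G (insert v P) u) + card (component G (insert u P) v) =
        card (component G (insert v P) u \<union> component G (insert u P) v)"
      using opposite_branches_disjoint[OF G v(2,3)] sub fin True
      by (intro card_Un_disjoint[symmetric]) (auto dest: finite_subset)
    also have "\<dots> \<le> card ?C" using sub True by (intro card_mono fin) blast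
    finally show False using vu w True by auto
  next
    case False
    have "card (component G (insert u P) w) < card (component G (insert v P) u)"
      using branch_descend[OF G v(2,3) _ False] w finite_subset[OF sub(1) fin]
      by (intro psubset_card_mono) auto
    then show False using minimal[OF w] by simp
  qed
qed

section \<open>Short walks, and acyclicity forced on the second graph\<close>

lemma short_walk:
  assumes G: "is_colored_graph I G" and x: "x \<in> verts G" and y: "y \<in> component G P x"
  shows "\<exists>k \<le> card (component G P x) * card (component G P x). (x, y) \<in> edges G P ^^ k"
proof -
  let ?C = "component G P x"
  let ?E = "edges G P \<inter> ?C \<times> ?C"
  have "(x, z) \<in> ?E\<^sup>*" if "(x, z) \<in> (edges G P)\<^sup>*" for z
    using that
  proof (induction rule: rtrancl_induct)
    case (step a b)
    then have "(a, b) \<in> ?E" by (auto simp: component_def intro: rtrancl_into_rtrancl)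
    with step.IH show ?case by (rule rtrancl_into_rtrancl)
  qed simp
  then obtain k where k: "(x, y) \<in> ?E ^^ k" using y unfolding component_def by (blast dest: rtrancl_imp_relpow)
  have fin: "finite (?C \<times> ?C)" using finite_component[OF G x] by simp
  have "finite ?E" using fin by (rule rev_finite_subset) blast
  from relpow_finite_bounded[OF this] k obtain j where j: "j \<le> card ?E" "(x, y) \<in> ?E ^^ j" by blast
  \<comment> \<open>A crude bound on the length, but it enters the number of rounds only through its
    logarithm.\<close>
  have "card ?E \<le> card (?C \<times> ?C)" by (intro card_mono fin) blast
  moreover have "(x, y) \<in> edges G P ^^ j" using j(2) unfolding relpow_fun_conv by blast
  ultimately show ?thesis using j(1) unfolding card_cartesian_product by (intro exI[of _ j]) simp
qed

text \<open>Spoiler halves a walk in every round, so \<open>q\<close> rounds control walks of length \<open>2 ^ q\<close>.\<close>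

lemma bf_walk:
  assumes G: "is_colored_graph I G"
  shows "bf I G H q R \<Longrightarrow> Z \<subseteq> R \<Longrightarrow> (y, y') \<in> R \<Longrightarrow> (z, z') \<in> R \<Longrightarrow> y \<in> verts G \<Longrightarrow>
    (y, z) \<in> edges G (fst ` Z) ^^ k \<Longrightarrow> k \<le> 2 ^ q \<Longrightarrow>
    \<exists>k' \<le> 2 ^ q. (y', z') \<in> edges H (snd ` Z) ^^ k'"
proof (induction q arbitrary: R y y' z z' k)
  case 0
  then have iso: "partial_iso I G H R" by simp
  show ?case
  proof (cases k)
    case 0
    then have "y' = z'" using "0.prems" partial_iso_eq[OF iso] by simp
    then show ?thesis by (intro exI[of _ 0]) simp
  next
    case (Suc j)
    then have "(y, z) \<in> edges G (fst ` Z)" using "0.prems" by simp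
    then have yz: "adj G y z" "y \<notin> fst ` Z" "z \<notin> fst ` Z" by (auto simp: edges_def)
    have "x' \<notin> snd ` Z" if "(x, x') \<in> R" "x \<notin> fst ` Z" for x x'
      using that partial_iso_eq[OF iso that(1)] "0.prems"(2) by force
    then have "(y', z') \<in> edges H (snd ` Z)"
      using "0.prems" yz partial_iso_adj[OF iso] by (auto simp: edges_def)
    then show ?thesis by (intro exI[of _ 1]) simp
  qed
next
  case (Suc q)
  define k1 where "k1 = min k (2 ^ q)"
  define k2 where "k2 = k - k1"
  have k: "k = k1 + k2" "k1 \<le> 2 ^ q" "k2 \<le> 2 ^ q" using Suc.prems(7) by (auto simp: k1_def k2_def)
  then obtain m where m: "(y, m) \<in> edges G (fst ` Z) ^^ k1" "(m, z) \<in> edges G (fst ` Z) ^^ k2"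
    using Suc.prems(6) by (auto simp: relpow_add)
  have "m \<in> component G (fst ` Z) y" using m(1) by (auto simp: component_def dest: relpow_imp_rtrancl)
  then have mv: "m \<in> verts G" using component_subset_verts[OF G Suc.prems(5)] by blast
  then obtain m' where m': "m' \<in> verts H" "bf I G H q (insert (m, m') R)" using Suc.prems(1) by auto
  obtain l1 where l1: "l1 \<le> 2 ^ q" "(y', m') \<in> edges H (snd ` Z) ^^ l1"
    using Suc.IH[OF m'(2) _ _ _ Suc.prems(5) m(1) k(2), of y' m'] Suc.prems by auto
  obtain l2 where l2: "l2 \<le> 2 ^ q" "(m', z') \<in> edges H (snd ` Z) ^^ l2"
    using Suc.IH[OF m'(2) _ _ _ mv m(2) k(3), of m' z'] Suc.prems by auto
  have "(y', z') \<in> edges H (snd ` Z) ^^ (l1 + l2)" using l1(2) l2(2) by (auto simp: relpow_add)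
  then show ?case using l1(1) l2(1) by (intro exI[of _ "l1 + l2"]) simp
qed

text \<open>Cut the walk after its last visit to \<open>x\<close>.\<close>

lemma first_step:
  "(x, w) \<in> edges G {} ^^ k \<Longrightarrow> w \<noteq> x \<Longrightarrow> \<exists>a j. adj G x a \<and> j \<le> k \<and> (a, w) \<in> edges G {x} ^^ j"
proof (induction k arbitrary: w)
  case (Suc k)
  then obtain y where y: "(x, y) \<in> edges G {} ^^ k" "adj G y w" by (auto simp: edges_def)
  show ?case
  proof (cases "y = x")
    case True
    then show ?thesis using y(2) by (intro exI[of _ w] exI[of _ 0]) simp
  next
    case False
    with Suc.IH[OF y(1)] obtain a j where aj: "adj G x a" "j \<le> k" "(a, y) \<in> edges G {x} ^^ j" by blast
    have "(y, w) \<in> edges G {x}" using y(2) False Suc.prems(2) by (simp add: edges_def)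
    then have "(a, w) \<in> edges G {x} ^^ Suc j" using aj(3) by (rule relpow_Suc_I[rotated])
    then show ?thesis using aj by (intro exI[of _ a] exI[of _ "Suc j"]) simp
  qed
qed simp

lemma relpow_sym:
  assumes "\<And>a b. (a, b) \<in> E \<Longrightarrow> (b, a) \<in> E"
  shows "(x, y) \<in> E ^^ k \<Longrightarrow> (y, x) \<in> E ^^ k"
proof (induction k arbitrary: y)
  case (Suc k)
  then obtain z where z: "(x, z) \<in> E ^^ k" "(z, y) \<in> E" by auto
  from assms[OF z(2)] Suc.IH[OF z(1)] show ?case by (rule relpow_Suc_I2)
qed simp

text \<open>In a graph of small diameter any cycle yields a short one: along a walk avoiding \<open>x\<close> the
  first steps of short walks from \<open>x\<close> cannot change without closing a short walk.\<close>

lemma treelike_if_no_short_cycles: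
  assumes H: "is_colored_graph I H"
    and diam: "\<And>x y. x \<in> verts H \<Longrightarrow> y \<in> verts H \<Longrightarrow> \<exists>k \<le> L. (x, y) \<in> edges H {} ^^ k"
    and short: "\<And>x y z k. adj H x y \<Longrightarrow> adj H x z \<Longrightarrow> y \<noteq> z \<Longrightarrow> k \<le> 2 * L + 1 \<Longrightarrow> (y, z) \<notin> edges H {x} ^^ k"
  shows "treelike I H"
  unfolding treelike_def
proof (intro conjI allI impI notI)
  fix x y z assume adj: "adj H x y" "adj H x z" and "y \<noteq> z" and yz: "(y, z) \<in> (edges H {x})\<^sup>*"
  have "\<exists>j \<le> L. (y, w) \<in> edges H {x} ^^ j" if "(y, w) \<in> (edges H {x})\<^sup>*" for w
    using that
  proof (induction rule: rtrancl_induct)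
    case base
    then show ?case by (intro exI[of _ 0]) simp
  next
    case (step w w')
    then obtain j where j: "j \<le> L" "(y, w) \<in> edges H {x} ^^ j" by blast
    have w': "w' \<noteq> x" "w' \<in> verts H" "x \<in> verts H"
      using step.hyps colored_graphD[OF H] adj(1) by (auto simp: edges_def)
    then obtain a i where a: "adj H x a" "i \<le> L" "(a, w') \<in> edges H {x} ^^ i"
      using diam[OF w'(3,2)] first_step[where G = H] by (meson le_trans)
    have "(w', a) \<in> edges H {x} ^^ i"
      by (rule relpow_sym[OF _ a(3)]) (use colored_graphD(5)[OF H] in \<open>auto simp: edges_def\<close>)
    then have "(w, a) \<in> edges H {x} ^^ Suc i" using step.hyps(2) by (rule relpow_Suc_I2[rotated])
    then have "(y, a) \<in> edges H {x} ^^ (j + Suc i)" using j(2) unfolding relpow_add by blast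
    \<comment> \<open>The walk from \<open>y\<close> through \<open>w\<close> and \<open>w'\<close>
      to \<open>a\<close> avoids \<open>x\<close> and has length at most \<open>2 * L + 1\<close>.
      So the bound \<open>L\<close> is restored after every step.\<close>
    then have "a = y" using short[OF adj(1) a(1), of "j + Suc i"] j(1) a(2) by fastforce
    then show ?case using a by blast
  qed
  then obtain j where "j \<le> L" "(y, z) \<in> edges H {x} ^^ j" using yz by blast
  then show False using short[OF adj \<open>y \<noteq> z\<close>, of j] by simp
qed (rule H)

lemma game_right:
  "game X Y P (Suc d) R \<Longrightarrow> y \<in> Y \<Longrightarrow> \<exists>x\<in>X. game X Y P d (insert (x, y) R)"
  by simp

text \<open>Two pebbles and \<open>q\<close> rounds show that any two vertices of \<open>H\<close>
  are joined by a walk of length at most \<open>2 ^ q\<close>, since their counterparts in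
  \<open>G\<close> are. Three pebbles and \<open>q + 2\<close> rounds carry a short cycle of
  \<open>H\<close> back to \<open>G\<close>, whence \<open>q + 5\<close>.\<close>

lemma treelike_transfer:
  assumes G: "treelike I G" "connected_graph G" "card (verts G) \<le> n" and H: "is_colored_graph I H"
    and q: "n * n \<le> 2 ^ q" and bf: "bf I G H (q + 5) {}"
  shows "treelike I H \<and> (\<forall>x\<in>verts H. component H {} x = verts H)"
proof -
  note graph = treelike_graph[OF G(1)]
  note ne = colored_graphD(2)[OF graph]
  have conn: "\<exists>k \<le> n * n. (x, y) \<in> edges G {} ^^ k" if "x \<in> verts G" "y \<in> verts G" for x y
  proof -
    have "(adj G)\<^sup>*\<^sup>* x y" using G(2) that by (auto simp: connected_graph_def)
    then have "y \<in> component G {} x"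
      by (induction rule: rtranclp_induct) (auto intro: component_step)
    moreover have "card (component G {} x) \<le> n"
      using card_mono[OF colored_graphD(1)[OF graph] component_subset_verts[OF graph that(1)]] G(3) by (rule le_trans)
    ultimately show ?thesis using short_walk[OF graph that(1)] mult_le_mono by (meson le_trans)
  qed
  have diam: "\<exists>k \<le> 2 ^ q. (x, y) \<in> edges H {} ^^ k" if "x \<in> verts H" "y \<in> verts H" for x y
  proof -
    have "bf I G H (Suc (Suc q)) {}"
      by (rule bf_le[OF ne bf]) simp
    from game_right[OF this that(1)] obtain x' where x': "x' \<in> verts G" "bf I G H (Suc q) {(x', x)}" by blast
    from game_right[OF x'(2) that(2)] obtain y' where y': "y' \<in> verts G" "bf I G H q {(y', y), (x', x)}"
      by blast
    note xy = x'(1) y'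
    obtain k where "k \<le> n * n" "(x', y') \<in> edges G {} ^^ k" using conn[OF xy(1,2)] by blast
    then show ?thesis using bf_walk[OF graph xy(3), of "{}" x' x y' y k] xy q by simp
  qed
  have "treelike I H"
  proof (rule treelike_if_no_short_cycles[OF H diam])
    fix x y z k :: nat
    assume adj: "adj H x y" "adj H x z" "y \<noteq> z" and k: "k \<le> 2 * 2 ^ q + 1"
    have "1 \<le> (2 :: nat) ^ q" by simp
    with k have "k \<le> 4 * 2 ^ q" by linarith
    then have k: "k \<le> 2 ^ (q + 2)" by (simp add: power_add)
    have v: "x \<in> verts H" "y \<in> verts H" "z \<in> verts H" using adj colored_graphD[OF H] by blast+
    have "q + 5 = Suc (Suc (Suc (q + 2)))" by simp
    with bf have "bf I G H (Suc (Suc (Suc (q + 2)))) {}" by (simp only:)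
    from game_right[OF this v(1)] obtain x' where x': "bf I G H (Suc (Suc (q + 2))) {(x', x)}" by blast
    from game_right[OF x' v(2)] obtain y' where y': "bf I G H (Suc (q + 2)) {(y', y), (x', x)}" by blast
    from game_right[OF y' v(3)] obtain z' where xyz: "bf I G H (q + 2) {(z', z), (y', y), (x', x)}" by blast
    show "(y, z) \<notin> edges H {x} ^^ k"
    proof
      assume walk: "(y, z) \<in> edges H {x} ^^ k"
      have conv: "{(z', z), (y', y), (x', x)}\<inverse> = {(z, z'), (y, y'), (x, x')}" by auto
      have "bf I H G (q + 2) {(z, z'), (y, y'), (x, x')}"
        using xyz unfolding bf_converse[where I = I and G = G and H = H] conv .
      then have "\<exists>k' \<le> 2 ^ (q + 2). (y', z') \<in> edges G (snd ` {(x, x')}) ^^ k'"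
        by (rule bf_walk[OF H, of _ _ _ "{(x, x')}" y y' z z' k]) (use walk k v(2) in simp_all)
      then have "(y', z') \<in> (edges G {x'})\<^sup>*" by (auto dest: relpow_imp_rtrancl)
      moreover note iso = bf_partial_iso[OF ne xyz]
      have "adj G x' y'" "adj G x' z'" "y' \<noteq> z'"
        using adj partial_iso_adj[OF iso, of x' x y' y] partial_iso_adj[OF iso, of x' x z' z]
          partial_iso_eq[OF iso, of y' y z' z] by simp_all
      ultimately show False using treelikeD[OF G(1)] by blast
    qed
  qed
  moreover have "component H {} x = verts H" if "x \<in> verts H" for x
    using component_subset_verts[OF H that, of "{}"] diam[OF that] by (auto simp: component_def dest: relpow_imp_rtrancl)
  ultimately show ?thesis by blast
qed

text \<open>A shortest walk from \<open>y\<close> to \<open>z\<close> outside \<open>x\<close>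
  repeats no vertex, so it closes to a cycle through \<open>x\<close>.\<close>

lemma tree_treelike:
  assumes "is_colored_tree I G"
  shows "treelike I G"
  unfolding treelike_def
proof (intro conjI allI impI notI)
  show G: "is_colored_graph I G" using assms by (simp add: is_colored_tree_def)
  fix x y z assume adj: "adj G x y" "adj G x z" and "y \<noteq> z" and yz: "(y, z) \<in> (edges G {x})\<^sup>*"
  define k where "k = (LEAST k. (y, z) \<in> edges G {x} ^^ k)"
  have k: "(y, z) \<in> edges G {x} ^^ k"
    unfolding k_def using rtrancl_imp_relpow[OF yz] by (rule LeastI_ex)
  have least: "k \<le> j" if "(y, z) \<in> edges G {x} ^^ j" for j
    unfolding k_def using that by (rule Least_le)
  obtain f where f: "f 0 = y" "f k = z" "\<And>i. i < k \<Longrightarrow> (f i, f (Suc i)) \<in> edges G {x}"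
    using k unfolding relpow_fun_conv by blast
  have k1: "k \<ge> 1" using f(1,2) \<open>y \<noteq> z\<close> by (cases k) auto
  have fx: "f i \<noteq> x \<and> f i \<in> verts G" if "i \<le> k" for i
  proof (cases "i < k")
    case True
    then show ?thesis using f(3)[of i] colored_graphD(3)[OF G] by (auto simp: edges_def)
  next
    case False
    then have "i = Suc (k - 1)" using that k1 by simp
    then show ?thesis using f(3)[of "k - 1"] k1 colored_graphD(4)[OF G] by (auto simp: edges_def)
  qed
  have part: "(f i, f j) \<in> edges G {x} ^^ (j - i)" if "i \<le> j" "j \<le> k" for i j
    unfolding relpow_fun_conv using that f(3) by (intro exI[of _ "\<lambda>m. f (i + m)"]) auto
  have "f i \<noteq> f j" if "i < j" "j \<le> k" for i j
  proof
    assume "f i = f j"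
    then have "(y, z) \<in> edges G {x} ^^ (i + (k - j))"
      using part[of 0 i] part[of j k] that f(1,2) unfolding relpow_add by (intro relcompI) simp_all
    then show False using least that by fastforce
  qed
  then have "inj_on f {0..<Suc k}" by (auto simp: inj_on_def) (metis less_Suc_eq_le nat_neq_iff)
  define c where "c = x # map f [0..<Suc k]"
  have "adj G (c ! i) (c ! (Suc i mod length c))" if i: "i < length c" for i
  proof (cases i)
    case 0
    then show ?thesis using adj(1) f(1) by (simp add: c_def del: upt_Suc)
  next
    case (Suc j)
    show ?thesis
    proof (cases "j < k")
      case True
      then have "c ! i = f j" "c ! (Suc i mod length c) = f (Suc j)" using Suc by (simp_all add: c_def del: upt_Suc)
      then show ?thesis using f(3)[OF True] by (simp add: edges_def)
    next
      case False
      then have "j = k" using i Suc by (simp add: c_def)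
      then have "c ! i = z" "c ! (Suc i mod length c) = x" using Suc f(2) by (simp_all add: c_def del: upt_Suc)
      then show ?thesis using adj(2) colored_graphD(5)[OF G] by simp
    qed
  qed
  moreover have "x \<notin> f ` {0..<Suc k}" using fx by (force simp: less_Suc_eq_le)
  then have "distinct c"
    unfolding c_def using \<open>inj_on f _\<close> by (simp add: distinct_map del: upt_Suc)
  moreover have "set c \<subseteq> verts G" using fx adj(1) colored_graphD(3)[OF G] by (auto simp: c_def less_Suc_eq_le)
  moreover have "length c \<ge> 3" using k1 by (simp add: c_def)
  ultimately have "is_cycle G c" by (simp add: is_cycle_def)
  then show False using assms by (auto simp: is_colored_tree_def)
qed

subsection \<open>Isomorphism of components\<close>

text \<open>The list \<open>ps\<close> consists of removed vertices. An isomorphism of components has to respect the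
  adjacency to them, which is the reason why colored trees appear naturally.\<close>

definition piece_iso :: "nat set \<Rightarrow> colored_graph \<Rightarrow> nat list \<Rightarrow> nat \<Rightarrow> colored_graph \<Rightarrow> nat list \<Rightarrow> nat \<Rightarrow> bool" where
  "piece_iso I G ps x H qs y \<longleftrightarrow> length ps = length qs \<and>
     (\<exists>f. bij_betw f (component G (set ps) x) (component H (set qs) y) \<and>
       (\<forall>u\<in>component G (set ps) x. \<forall>v\<in>component G (set ps) x. adj G u v \<longleftrightarrow> adj H (f u) (f v)) \<and>
       (\<forall>u\<in>component G (set ps) x. (\<forall>i\<in>I. u \<in> color G i \<longleftrightarrow> f u \<in> color H i) \<and>
          (\<forall>i<length ps. adj G u (ps ! i) \<longleftrightarrow> adj H (f u) (qs ! i))))"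

lemma piece_iso_refl: "piece_iso I G ps x G ps x"
  unfolding piece_iso_def by (intro conjI exI[of _ "\<lambda>u. u"]) (simp_all add: bij_betw_def)

lemma piece_iso_sym:
  assumes "piece_iso I G ps x H qs y"
  shows "piece_iso I H qs y G ps x"
proof -
  let ?A = "component G (set ps) x" and ?B = "component H (set qs) y"
  obtain f where f: "bij_betw f ?A ?B" and adj: "\<And>u v. u \<in> ?A \<Longrightarrow> v \<in> ?A \<Longrightarrow> adj G u v \<longleftrightarrow> adj H (f u) (f v)"
    and loc: "\<And>u. u \<in> ?A \<Longrightarrow> (\<forall>i\<in>I. u \<in> color G i \<longleftrightarrow> f u \<in> color H i) \<and>
          (\<forall>i<length ps. adj G u (ps ! i) \<longleftrightarrow> adj H (f u) (qs ! i))"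
    and len: "length ps = length qs"
    using assms unfolding piece_iso_def by blast
  define g where "g = inv_into ?A f"
  have g: "bij_betw g ?B ?A" unfolding g_def by (rule bij_betw_inv_into[OF f])
  have fg: "g u \<in> ?A" "f (g u) = u" if "u \<in> ?B" for u
    using that f by (auto simp: g_def bij_betw_def f_inv_into_f inv_into_into)
  have "adj H u v \<longleftrightarrow> adj G (g u) (g v)" if "u \<in> ?B" "v \<in> ?B" for u v
    using adj[OF fg(1)[OF that(1)] fg(1)[OF that(2)]] fg(2)[OF that(1)] fg(2)[OF that(2)] by simp
  moreover have "(\<forall>i\<in>I. u \<in> color H i \<longleftrightarrow> g u \<in> color G i) \<and>
          (\<forall>i<length qs. adj H u (qs ! i) \<longleftrightarrow> adj G (g u) (ps ! i))" if "u \<in> ?B" for u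
    using loc[OF fg(1)[OF that]] fg(2)[OF that] len by simp
  ultimately show ?thesis unfolding piece_iso_def using len g by (intro conjI exI[of _ g]) auto
qed

lemma piece_iso_trans:
  assumes "piece_iso I G ps x H qs y" "piece_iso I H qs y K ts z"
  shows "piece_iso I G ps x K ts z"
proof -
  let ?A = "component G (set ps) x" and ?B = "component H (set qs) y" and ?C = "component K (set ts) z"
  obtain f where f: "bij_betw f ?A ?B" and f_adj: "\<And>u v. u \<in> ?A \<Longrightarrow> v \<in> ?A \<Longrightarrow> adj G u v \<longleftrightarrow> adj H (f u) (f v)"
    and f_loc: "\<And>u. u \<in> ?A \<Longrightarrow> (\<forall>i\<in>I. u \<in> color G i \<longleftrightarrow> f u \<in> color H i) \<and>
          (\<forall>i<length ps. adj G u (ps ! i) \<longleftrightarrow> adj H (f u) (qs ! i))"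
    and len1: "length ps = length qs"
    using assms(1) unfolding piece_iso_def by blast
  obtain g where g: "bij_betw g ?B ?C" and g_adj: "\<And>u v. u \<in> ?B \<Longrightarrow> v \<in> ?B \<Longrightarrow> adj H u v \<longleftrightarrow> adj K (g u) (g v)"
    and g_loc: "\<And>u. u \<in> ?B \<Longrightarrow> (\<forall>i\<in>I. u \<in> color H i \<longleftrightarrow> g u \<in> color K i) \<and>
          (\<forall>i<length qs. adj H u (qs ! i) \<longleftrightarrow> adj K (g u) (ts ! i))"
    and len2: "length qs = length ts"
    using assms(2) unfolding piece_iso_def by blast
  have fB: "f u \<in> ?B" if "u \<in> ?A" for u using f that by (auto simp: bij_betw_def)
  have "adj G u v \<longleftrightarrow> adj K ((g \<circ> f) u) ((g \<circ> f) v)" if "u \<in> ?A" "v \<in> ?A" for u v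
    using f_adj[OF that] g_adj[OF fB[OF that(1)] fB[OF that(2)]] by simp
  moreover have "(\<forall>i\<in>I. u \<in> color G i \<longleftrightarrow> (g \<circ> f) u \<in> color K i) \<and>
          (\<forall>i<length ps. adj G u (ps ! i) \<longleftrightarrow> adj K ((g \<circ> f) u) (ts ! i))" if "u \<in> ?A" for u
    using f_loc[OF that] g_loc[OF fB[OF that]] len1 by simp
  moreover have "bij_betw (g \<circ> f) ?A ?C" using f g by (rule bij_betw_trans)
  ultimately show ?thesis unfolding piece_iso_def using len1 len2
    by (intro conjI exI[of _ "g \<circ> f"]) auto
qed

lemma piece_iso_card:
  "piece_iso I G ps x H qs y \<Longrightarrow> card (component G (set ps) x) = card (component H (set qs) y)"
  unfolding piece_iso_def by (auto dest: bij_betw_same_card)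

text \<open>The isomorphism class as a value: types of branches of different graphs can be compared
  by equality, and multiplicities become cardinalities of fibers.\<close>

definition piece_type :: "nat set \<Rightarrow> colored_graph \<Rightarrow> nat list \<Rightarrow> nat \<Rightarrow> (colored_graph \<times> nat list \<times> nat) set" where
  "piece_type I G ps x = {(H, qs, y). piece_iso I G ps x H qs y}"

lemma piece_type_eq_iff: "piece_type I G ps x = piece_type I H qs y \<longleftrightarrow> piece_iso I G ps x H qs y"
proof
  assume "piece_type I G ps x = piece_type I H qs y"
  moreover have "(H, qs, y) \<in> piece_type I H qs y" by (simp add: piece_type_def piece_iso_refl)
  ultimately have "(H, qs, y) \<in> piece_type I G ps x" by blast
  then show "piece_iso I G ps x H qs y" by (simp add: piece_type_def)
next
  assume iso: "piece_iso I G ps x H qs y"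
  show "piece_type I G ps x = piece_type I H qs y"
    unfolding piece_type_def using piece_iso_trans[OF iso] piece_iso_trans[OF piece_iso_sym[OF iso]] by blast
qed

lemma component_branches:
  assumes "is_colored_graph I G" "v \<notin> P"
  shows "component G P v = insert v (\<Union>u\<in>nbrs G P v. component G (insert v P) u)"
  using component_decomp[OF assms(1), of _ P v] branch_subset[OF assms] by auto

text \<open>With \<open>v\<close> in front of \<open>ps\<close>, the branch isomorphisms respect
  adjacency to \<open>v\<close> (entry 0) and to the vertices removed earlier (entries
  \<open>Suc i\<close>). As there are no edges between different branches, their union together with
  sending \<open>v\<close> to \<open>v'\<close> respects everything.\<close>

lemma piece_iso_glue:
  assumes G: "treelike I G" and H: "treelike I H"
    and v: "v \<notin> set ps" and v': "v' \<notin> set qs" and len: "length ps = length qs"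
    and col: "\<forall>i\<in>I. v \<in> color G i \<longleftrightarrow> v' \<in> color H i"
    and bd: "\<forall>i<length ps. adj G v (ps ! i) \<longleftrightarrow> adj H v' (qs ! i)"
    and \<beta>: "bij_betw \<beta> (nbrs G (set ps) v) (nbrs H (set qs) v')"
    and iso: "\<forall>u\<in>nbrs G (set ps) v. piece_iso I G (v # ps) u H (v' # qs) (\<beta> u)"
  shows "piece_iso I G ps v H qs v'"
proof -
  note gG = treelike_graph[OF G] and gH = treelike_graph[OF H]
  let ?N = "nbrs G (set ps) v" and ?N' = "nbrs H (set qs) v'"
  let ?A = "\<lambda>u. component G (insert v (set ps)) u" and ?B = "\<lambda>u. component H (insert v' (set qs)) u"
  have "\<forall>u\<in>?N. \<exists>f. bij_betw f (?A u) (?B (\<beta> u)) \<and>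
       (\<forall>x\<in>?A u. \<forall>y\<in>?A u. adj G x y \<longleftrightarrow> adj H (f x) (f y)) \<and>
       (\<forall>x\<in>?A u. (\<forall>i\<in>I. x \<in> color G i \<longleftrightarrow> f x \<in> color H i) \<and>
          (\<forall>i<length (v # ps). adj G x ((v # ps) ! i) \<longleftrightarrow> adj H (f x) ((v' # qs) ! i)))"
    using iso unfolding piece_iso_def list.set by blast
  from bchoice[OF this] obtain F where F: "\<forall>u\<in>?N. bij_betw (F u) (?A u) (?B (\<beta> u)) \<and>
       (\<forall>x\<in>?A u. \<forall>y\<in>?A u. adj G x y \<longleftrightarrow> adj H (F u x) (F u y)) \<and>
       (\<forall>x\<in>?A u. (\<forall>i\<in>I. x \<in> color G i \<longleftrightarrow> F u x \<in> color H i) \<and>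
          (\<forall>i<length (v # ps). adj G x ((v # ps) ! i) \<longleftrightarrow> adj H (F u x) ((v' # qs) ! i)))"
    by (elim exE)
  have F_bij: "bij_betw (F u) (?A u) (?B (\<beta> u))" if "u \<in> ?N" for u using F that by blast
  have F_adj: "adj G x y \<longleftrightarrow> adj H (F u x) (F u y)" if "u \<in> ?N" "x \<in> ?A u" "y \<in> ?A u" for u x y
    using F that by blast
  have F_col: "x \<in> color G i \<longleftrightarrow> F u x \<in> color H i" if "u \<in> ?N" "x \<in> ?A u" "i \<in> I" for u x i
    using F that by blast
  have F_bd: "adj G x ((v # ps) ! i) \<longleftrightarrow> adj H (F u x) ((v' # qs) ! i)"
    if "u \<in> ?N" "x \<in> ?A u" "i < length (v # ps)" for u x i
    using F that by blast
  have F_in: "F u x \<in> ?B (\<beta> u)" if "u \<in> ?N" "x \<in> ?A u" for u x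
    using bij_betwE[OF F_bij[OF that(1)]] that(2) by blast
  have \<beta>_in: "\<beta> u \<in> ?N'" if "u \<in> ?N" for u using bij_betwE[OF \<beta>] that by blast
  have v_notin: "v \<notin> ?A u" if "u \<in> ?N" for u using branch_subset[OF gG v that] by blast
  have v'_notin: "v' \<notin> ?B u" if "u \<in> ?N'" for u using branch_subset[OF gH v' that] by blast
  have uniq: "w = u" if "u \<in> ?N" "w \<in> ?N" "x \<in> ?A u" "x \<in> ?A w" for u w x
    using branch_disjoint[OF G that(1,2)] that(3,4) by blast
  have uniq': "w = u" if "u \<in> ?N'" "w \<in> ?N'" "x \<in> ?B u" "x \<in> ?B w" for u w x
    using branch_disjoint[OF H that(1,2)] that(3,4) by blast
  define f where "f x = (if x = v then v' else F (THE u. u \<in> ?N \<and> x \<in> ?A u) x)" for x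
  have f_v: "f v = v'" by (simp add: f_def)
  have f_br: "f x = F u x" if "u \<in> ?N" "x \<in> ?A u" for u x
  proof -
    have "(THE u. u \<in> ?N \<and> x \<in> ?A u) = u" by (rule the_equality) (use that uniq in blast)+
    then show ?thesis using v_notin[OF that(1)] that(2) by (auto simp: f_def)
  qed
  have CG: "component G (set ps) v = insert v (\<Union>u\<in>?N. ?A u)" by (rule component_branches[OF gG v])
  have CH: "component H (set qs) v' = insert v' (\<Union>u\<in>?N'. ?B u)" by (rule component_branches[OF gH v'])
  have cases: "x = v \<or> (\<exists>u\<in>?N. x \<in> ?A u)" if "x \<in> component G (set ps) v" for x
    using that unfolding CG by blast
  have sep: "\<not> adj G x y" if "u \<in> ?N" "w \<in> ?N" "u \<noteq> w" "x \<in> ?A u" "y \<in> ?A w" for u w x y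
  proof
    assume "adj G x y"
    moreover have "x \<notin> insert v (set ps)" "y \<notin> insert v (set ps)"
      using component_notin[OF that(4) nbrs_notin[OF gG that(1)]] component_notin[OF that(5) nbrs_notin[OF gG that(2)]] .
    ultimately have "y \<in> ?A u" using component_step[OF that(4)] by blast
    then show False using uniq[OF that(1,2) _ that(5)] that(3) by blast
  qed
  have sep': "\<not> adj H x y" if "u \<in> ?N'" "w \<in> ?N'" "u \<noteq> w" "x \<in> ?B u" "y \<in> ?B w" for u w x y
  proof
    assume "adj H x y"
    moreover have "x \<notin> insert v' (set qs)" "y \<notin> insert v' (set qs)"
      using component_notin[OF that(4) nbrs_notin[OF gH that(1)]] component_notin[OF that(5) nbrs_notin[OF gH that(2)]] .
    ultimately have "y \<in> ?B u" using component_step[OF that(4)] by blast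
    then show False using uniq'[OF that(1,2) _ that(5)] that(3) by blast
  qed
  have \<beta>_inj: "u = w" if "u \<in> ?N" "w \<in> ?N" "\<beta> u = \<beta> w" for u w
    using \<beta> that by (auto simp: bij_betw_def inj_on_def)
  have inj: "inj_on f (component G (set ps) v)"
  proof (rule inj_onI)
    fix x y assume x: "x \<in> component G (set ps) v" and y: "y \<in> component G (set ps) v" and eq: "f x = f y"
    have mixed: False if "u \<in> ?N" "z \<in> ?A u" "f z = v'" for u z
      using F_in[OF that(1,2)] f_br[OF that(1,2)] that(3) v'_notin[OF \<beta>_in[OF that(1)]] by simp
    from cases[OF x] cases[OF y] show "x = y"
    proof (elim disjE bexE)
      fix u w assume u: "u \<in> ?N" "x \<in> ?A u" and w: "w \<in> ?N" "y \<in> ?A w"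
      have "\<beta> w = \<beta> u"
        by (rule uniq'[OF \<beta>_in[OF u(1)] \<beta>_in[OF w(1)], of "f x"])
          (use F_in[OF u] F_in[OF w] f_br[OF u] f_br[OF w] eq in simp_all)
      then have "w = u" using \<beta>_inj u(1) w(1) by blast
      then have "F u x = F u y" using f_br[OF u] f_br[OF w] eq by simp
      then show ?thesis using F_bij[OF u(1)] u(2) w(2) \<open>w = u\<close> by (auto simp: bij_betw_def inj_on_def)
    qed (use mixed eq f_v in auto)
  qed
  have img: "f ` (component G (set ps) v) = component H (set qs) v'"
  proof -
    have br: "f ` ?A u = ?B (\<beta> u)" if "u \<in> ?N" for u
    proof -
      have "f ` ?A u = F u ` ?A u" by (rule image_cong[OF refl]) (rule f_br[OF that])
      then show ?thesis using F_bij[OF that] by (simp add: bij_betw_def)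
    qed
    have "f ` (component G (set ps) v) = insert v' (\<Union>u\<in>?N. f ` ?A u)"
      unfolding CG using f_v by (simp add: image_UN)
    also have "(\<Union>u\<in>?N. f ` ?A u) = (\<Union>w\<in>\<beta> ` ?N. ?B w)" using br by simp
    also have "\<beta> ` ?N = ?N'" using \<beta> by (simp add: bij_betw_def)
    finally show ?thesis unfolding CH .
  qed
  have adj: "adj G x y \<longleftrightarrow> adj H (f x) (f y)"
    if x: "x \<in> component G (set ps) v" and y: "y \<in> component G (set ps) v" for x y
  proof -
    have root: "adj G z v \<longleftrightarrow> adj H (f z) v'" if "u \<in> ?N" "z \<in> ?A u" for u z
      using F_bd[OF that, of 0] f_br[OF that] by simp
    have symG: "adj G a b \<longleftrightarrow> adj G b a" for a b using colored_graphD(5)[OF gG] by blast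
    have symH: "adj H a b \<longleftrightarrow> adj H b a" for a b using colored_graphD(5)[OF gH] by blast
    from cases[OF x] cases[OF y] show ?thesis
    proof (elim disjE bexE)
      assume "x = v" "y = v"
      then show ?thesis using colored_graphD(6)[OF gG] colored_graphD(6)[OF gH] by simp
    next
      fix u assume "x = v" "u \<in> ?N" "y \<in> ?A u"
      then show ?thesis using root[of u y] f_v symG[of v y] symH[of v' "f y"] by simp
    next
      fix u assume "y = v" "u \<in> ?N" "x \<in> ?A u"
      then show ?thesis using root[of u x] f_v by simp
    next
      fix u w assume u: "u \<in> ?N" "x \<in> ?A u" and w: "w \<in> ?N" "y \<in> ?A w"
      show ?thesis
      proof (cases "u = w")
        case True
        then show ?thesis using F_adj[OF u, of y] f_br[OF u] f_br[OF w] w by simp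
      next
        case False
        then have "\<beta> u \<noteq> \<beta> w" using \<beta>_inj u(1) w(1) by blast
        then have "\<not> adj H (f x) (f y)"
          using sep'[OF \<beta>_in[OF u(1)] \<beta>_in[OF w(1)] _ F_in[OF u] F_in[OF w]] f_br[OF u] f_br[OF w] by simp
        then show ?thesis using sep[OF u(1) w(1) False u(2) w(2)] by simp
      qed
    qed
  qed
  have loc: "(\<forall>i\<in>I. x \<in> color G i \<longleftrightarrow> f x \<in> color H i) \<and>
      (\<forall>i<length ps. adj G x (ps ! i) \<longleftrightarrow> adj H (f x) (qs ! i))"
    if x: "x \<in> component G (set ps) v" for x
    using cases[OF x]
  proof (elim disjE bexE)
    assume "x = v"
    then show ?thesis using col bd f_v by simp
  next
    fix u assume u: "u \<in> ?N" "x \<in> ?A u"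
    have "adj G x (ps ! i) \<longleftrightarrow> adj H (f x) (qs ! i)" if "i < length ps" for i
      using F_bd[OF u, of "Suc i"] f_br[OF u] that by simp
    then show ?thesis using F_col[OF u] f_br[OF u] by simp
  qed
  show ?thesis unfolding piece_iso_def
    using len inj img adj loc by (intro conjI exI[of _ f]) (auto simp: bij_betw_def)
qed

subsection \<open>Counting types\<close>

lemma fiberwise_bijection:
  assumes fin: "finite N" "finite N'" and eq: "\<And>c. card {u\<in>N. t u = c} = card {w\<in>N'. t' w = c}"
  shows "\<exists>\<beta>. bij_betw \<beta> N N' \<and> (\<forall>u\<in>N. t u = t' (\<beta> u))"
proof -
  have "\<exists>b. bij_betw b {u\<in>N. t u = c} {w\<in>N'. t' w = c}" for c
    using fin eq[of c] by (intro finite_same_card_bij) auto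
  then obtain b where b: "\<And>c. bij_betw (b c) {u\<in>N. t u = c} {w\<in>N'. t' w = c}" by metis
  define \<beta> where "\<beta> u = b (t u) u" for u
  have \<beta>: "\<beta> u \<in> N' \<and> t' (\<beta> u) = t u" if "u \<in> N" for u
    using bij_betwE[OF b[of "t u"]] that by (auto simp: \<beta>_def)
  have "inj_on \<beta> N"
  proof (rule inj_onI)
    fix u w assume uw: "u \<in> N" "w \<in> N" "\<beta> u = \<beta> w"
    then have "t u = t w" using \<beta> by metis
    then show "u = w" using b[of "t u"] uw by (auto simp: \<beta>_def bij_betw_def inj_on_def)
  qed
  moreover have "N' \<subseteq> \<beta> ` N"
  proof
    fix w assume "w \<in> N'"
    then have "w \<in> b (t' w) ` {u\<in>N. t u = t' w}" using b[of "t' w"] by (auto simp: bij_betw_def)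
    then obtain u where "u \<in> N" "t u = t' w" "w = b (t' w) u" by blast
    then have "w = \<beta> u" by (simp add: \<beta>_def)
    then show "w \<in> \<beta> ` N" using \<open>u \<in> N\<close> by blast
  qed
  ultimately show ?thesis using \<beta> by (intro exI[of _ \<beta>]) (auto simp: bij_betw_def)
qed

text \<open>For the case that only one side has types in excess: then the degrees differ, which
  \<open>l + 1\<close> rounds expose.\<close>

lemma card_less_if_fibers_less:
  assumes fin: "finite N" "finite N'"
    and le: "\<And>c. card {u\<in>N. t u = c} \<le> card {w\<in>N'. t' w = c}"
    and less: "card {u\<in>N. t u = c0} < card {w\<in>N'. t' w = c0}"
  shows "card N < card N'"
proof -
  define T where "T = t ` N \<union> t' ` N'"
  have finT: "finite T" using fin by (simp add: T_def)
  have "{w\<in>N'. t' w = c0} \<noteq> {}" using less by (metis card.empty not_less_zero)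
  then have "c0 \<in> T" by (auto simp: T_def)
  then have "(\<Sum>c\<in>T. card {u\<in>N. t u = c}) < (\<Sum>c\<in>T. card {w\<in>N'. t' w = c})"
    using finT le less by (intro sum_strict_mono_ex1) auto
  moreover have "(\<Sum>c\<in>T. card {u\<in>N. t u = c}) = card N"
    using sum.group[OF fin(1) finT, of t "\<lambda>_. 1 :: nat"] by (auto simp: T_def)
  moreover have "(\<Sum>c\<in>T. card {w\<in>N'. t' w = c}) = card N'"
    using sum.group[OF fin(2) finT, of t' "\<lambda>_. 1 :: nat"] by (auto simp: T_def)
  ultimately show ?thesis by simp
qed

text \<open>The factor \<open>1/2\<close> of the theorem: if one type is in excess on the left and another one on the
  right, then the smaller of the two multiplicities to be exceeded is less than half the degree.\<close>

lemma type_count_cases: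
  fixes t :: "'a \<Rightarrow> 'c" and t' :: "'b \<Rightarrow> 'c"
  assumes fin: "finite N" "finite N'" and l: "card N \<le> l \<or> card N' \<le> l"
  obtains (matched) \<beta> where "bij_betw \<beta> N N'" "\<forall>u\<in>N. t u = t' (\<beta> u)"
  | (left) c U where "U \<subseteq> N" "\<forall>u\<in>U. t u = c" "1 \<le> card U" "2 * card U \<le> l + 1"
      "card {w\<in>N'. t' w = c} < card U"
  | (right) c U where "U \<subseteq> N'" "\<forall>w\<in>U. t' w = c" "1 \<le> card U" "2 * card U \<le> l + 1"
      "card {u\<in>N. t u = c} < card U"
  | (unequal) "card N \<noteq> card N'"
proof -
  let ?m = "\<lambda>c. card {u\<in>N. t u = c}" and ?m' = "\<lambda>c. card {w\<in>N'. t' w = c}"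
  consider (eq) "\<forall>c. ?m c = ?m' c" | (both) c c' where "?m' c < ?m c" "?m c' < ?m' c'"
    | (less) c where "?m c < ?m' c" "\<forall>c. ?m c \<le> ?m' c" | (greater) c where "?m' c < ?m c" "\<forall>c. ?m' c \<le> ?m c"
  proof (cases "\<forall>c. ?m c \<le> ?m' c")
    case True
    show thesis
    proof (cases "\<forall>c. ?m' c \<le> ?m c")
      case True
      then show thesis using \<open>\<forall>c. ?m c \<le> ?m' c\<close> by (intro eq) (simp add: le_antisym)
    qed (use less True not_le in blast)
  next
    case False
    then show thesis
    proof (cases "\<forall>c. ?m' c \<le> ?m c")
      case True
      then show thesis using greater False not_le by blast
    qed (use both False not_le in blast)
  qed
  then show thesis
  proof cases
    case eq
    then show thesis using fiberwise_bijection[OF fin, of t t'] matched by blast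
  next
    case (both c c')
    have "c \<noteq> c'" using both by auto
    \<comment> \<open>\<open>a\<close>, \<open>b\<close> are the multiplicities of \<open>c\<close>,
      \<open>c'\<close> on the left, \<open>a'\<close>, \<open>b'\<close> those on the right.
      Whichever side has at most \<open>l\<close> elements, \<open>a' + b + 1 \<le> l\<close>
      follows, so the smaller one of \<open>Suc a'\<close> and \<open>Suc b\<close> is at most
      \<open>(l + 1) / 2\<close>.\<close>
    have half: "2 * Suc a' \<le> l + 1 \<or> 2 * Suc b \<le> l + 1"
      if "a + b \<le> n" "a' + b' \<le> n'" "a' < a" "b < b'" "n \<le> l \<or> n' \<le> l" for a b a' b' n n' :: nat
      using that by presburger
    have mult: "?m c + ?m c' \<le> card N"
      using fin(1) \<open>c \<noteq> c'\<close> by (subst card_Un_disjoint[symmetric]) (auto intro!: card_mono)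
    have mult': "?m' c + ?m' c' \<le> card N'"
      using fin(2) \<open>c \<noteq> c'\<close> by (subst card_Un_disjoint[symmetric]) (auto intro!: card_mono)
    have "2 * Suc (?m' c) \<le> l + 1 \<or> 2 * Suc (?m c') \<le> l + 1"
      by (rule half[OF mult mult' both l])
    then consider "2 * Suc (?m' c) \<le> l + 1" | "2 * Suc (?m c') \<le> l + 1" by blast
    then show thesis
    proof cases
      case 1
      obtain U where U: "U \<subseteq> {u\<in>N. t u = c}" "card U = Suc (?m' c)"
        using obtain_subset_with_card_n[of "Suc (?m' c)" "{u\<in>N. t u = c}"] both by auto
      show thesis by (rule left[of U c]) (use U 1 in auto)
    next
      case 2
      obtain U where U: "U \<subseteq> {w\<in>N'. t' w = c'}" "card U = Suc (?m c')"
        using obtain_subset_with_card_n[of "Suc (?m c')" "{w\<in>N'. t' w = c'}"] both by auto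
      show thesis by (rule right[of U c']) (use U 2 in auto)
    qed
  next
    case (less c)
    then show thesis using card_less_if_fibers_less[OF fin, of t t' c] unequal by simp
  next
    case (greater c)
    then show thesis using card_less_if_fibers_less[OF fin(2,1), of t' t c] unequal by simp
  qed
qed

subsection \<open>Spoiler's strategy\<close>

text \<open>The degree bound is a disjunction because only one of the graphs is known to obey it,
  and the two get exchanged. \<open>R\<close> may contain more than \<open>zip ps qs\<close>, for
  instance pebbled neighbours that were not pursued; these are not removed.\<close>

definition position :: "nat set \<Rightarrow> nat \<Rightarrow> colored_graph \<Rightarrow> colored_graph \<Rightarrow> nat list \<Rightarrow> nat list \<Rightarrow> nat \<Rightarrow> nat \<Rightarrow>
    (nat \<times> nat) set \<Rightarrow> bool" where
  "position I l G H ps qs r r' R \<longleftrightarrow> treelike I G \<and> treelike I H \<and>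
     ((\<forall>v\<in>verts G. degree G v \<le> l) \<or> (\<forall>v\<in>verts H. degree H v \<le> l)) \<and>
     length ps = length qs \<and> set (zip ps qs) \<subseteq> R \<and> (r, r') \<in> R \<and>
     r \<notin> set ps \<and> r' \<notin> set qs \<and> r \<in> verts G \<and> r' \<in> verts H"

lemma position_converse:
  assumes "position I l G H ps qs r r' R"
  shows "position I l H G qs ps r' r (R\<inverse>)"
proof -
  have "set (zip qs ps) = (set (zip ps qs))\<inverse>" by (auto simp: in_set_zip)
  then show ?thesis using assms unfolding position_def by auto
qed

lemma fst_set_zip: "length ps = length qs \<Longrightarrow> fst ` set (zip ps qs) = set ps"
  by (metis list.set_map map_fst_zip)

lemma snd_set_zip: "length ps = length qs \<Longrightarrow> snd ` set (zip ps qs) = set qs"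
  by (metis list.set_map map_snd_zip)

section \<open>Neighbours of pebbled vertices\<close>

lemma pebbled_iff:
  assumes iso: "partial_iso I G H R" and zip: "length ps = length qs" "set (zip ps qs) \<subseteq> R" and u: "(u, u') \<in> R"
  shows "u \<in> set ps \<longleftrightarrow> u' \<in> set qs"
proof
  assume "u \<in> set ps"
  then obtain i where i: "i < length ps" "ps ! i = u" by (auto simp: in_set_conv_nth)
  then have "(ps ! i, qs ! i) \<in> R" using zip by (auto simp: set_zip)
  then have "qs ! i = u'" using partial_iso_eq[OF iso u] i by blast
  then show "u' \<in> set qs" using i zip by auto
next
  assume "u' \<in> set qs"
  then obtain i where i: "i < length qs" "qs ! i = u'" by (auto simp: in_set_conv_nth)
  then have "(ps ! i, qs ! i) \<in> R" using zip by (auto simp: set_zip)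
  then have "ps ! i = u" using partial_iso_eq[OF iso u] i by blast
  then show "u \<in> set ps" using i zip by auto
qed

lemma nbrs_iff:
  assumes "partial_iso I G H R" "length ps = length qs" "set (zip ps qs) \<subseteq> R" "(v, v') \<in> R" "(u, u') \<in> R"
  shows "u \<in> nbrs G (set ps) v \<longleftrightarrow> u' \<in> nbrs H (set qs) v'"
  using pebbled_iff[OF assms(1-3,5)] partial_iso_adj[OF assms(1,4,5)] by (simp add: nbrs_def)

text \<open>Pigeonhole: Spoiler pebbles one neighbour more than \<open>v'\<close> has, and the
  answers would have to be distinct neighbours of \<open>v'\<close> outside
  \<open>qs\<close>.\<close>

lemma bf_nbrs_card_le:
  assumes graphs: "is_colored_graph I G" "is_colored_graph I H"
    and bf: "bf I G H d R" and zip: "length ps = length qs" "set (zip ps qs) \<subseteq> R" and v: "(v, v') \<in> R"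
    and d: "Suc (card (nbrs H (set qs) v')) \<le> d"
  shows "card (nbrs G (set ps) v) \<le> card (nbrs H (set qs) v')"
proof (rule ccontr)
  let ?N = "nbrs G (set ps) v" and ?N' = "nbrs H (set qs) v'"
  note ne = colored_graphD(2)[OF graphs(1)]
  assume "\<not> ?thesis"
  then obtain U where U: "U \<subseteq> ?N" "card U = Suc (card ?N')" "finite U"
    using obtain_subset_with_card_n[of "Suc (card ?N')" ?N] finite_nbrs[OF graphs(1)] by (metis not_less_eq_eq)
  have sub: "U \<subseteq> verts G" using U(1) nbrs_verts[OF graphs(1)] by blast
  have "bf I G H (0 + card U) R" by (rule bf_le[OF ne bf]) (use d U(2) in simp)
  from game_choose_left[OF U(3) sub this] obtain f where iso: "partial_iso I G H (R \<union> (\<lambda>u. (u, f u)) ` U)"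
    unfolding game.simps by blast
  have "f ` U \<subseteq> ?N'"
    using nbrs_iff[OF iso zip(1), of v v'] zip(2) v U(1) by blast
  moreover have "inj_on f U"
    by (rule inj_onI) (use partial_iso_eq[OF iso] in blast)
  ultimately have "card U \<le> card ?N'" using finite_nbrs[OF graphs(2)] by (metis card_inj_on_le)
  then show False using U(2) by simp
qed

text \<open>The side with at most \<open>l\<close> neighbours bounds the other side first; then
  \<open>l + 1\<close> rounds suffice for the reverse comparison too.\<close>

lemma bf_nbrs_card_eq:
  assumes graphs: "is_colored_graph I G" "is_colored_graph I H"
    and bf: "bf I G H d R" and zip: "length ps = length qs" "set (zip ps qs) \<subseteq> R" and v: "(v, v') \<in> R"
    and l: "card (nbrs G (set ps) v) \<le> l \<or> card (nbrs H (set qs) v') \<le> l" and d: "l + 1 \<le> d"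
  shows "card (nbrs G (set ps) v) = card (nbrs H (set qs) v')"
proof (rule ccontr)
  let ?n = "card (nbrs G (set ps) v)" and ?n' = "card (nbrs H (set qs) v')"
  assume neq: "\<not> ?thesis"
  have "set (zip qs ps) \<subseteq> R\<inverse>" using zip by (auto simp: set_zip)
  moreover have "bf I H G d (R\<inverse>)" using bf by (subst (asm) bf_converse)
  ultimately have "Suc ?n \<le> d \<Longrightarrow> ?n' \<le> ?n"
    using bf_nbrs_card_le[OF graphs(2,1), of d "R\<inverse>" qs ps v' v] zip(1) v by auto
  moreover have "Suc ?n' \<le> d \<Longrightarrow> ?n \<le> ?n'"
    using bf_nbrs_card_le[OF graphs bf zip v] .
  ultimately show False using neq l d by linarith
qed

text \<open>\<open>2 ^ q\<close> bounds the walks needed in components of order at most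
  \<open>n\<close>. \<open>\<alpha>_large\<close> compares the price of a stage, one centroid and
  \<open>k\<close> neighbours, with the drop of the potential: the factor 2 is due to the centroid,
  and \<open>k\<close> to the smallest of \<open>k\<close> disjoint branches.\<close>

locale spoiler =
  fixes I :: "nat set" and l n q :: nat and \<alpha> :: real
  assumes q: "n * n \<le> 2 ^ q" and \<alpha>: "\<alpha> \<ge> 0"
    and \<alpha>_large: "\<And>k. k \<ge> 1 \<Longrightarrow> 2 * k \<le> l + 1 \<Longrightarrow> 1 + real k \<le> \<alpha> * ln (real (max 2 k))"
begin

text \<open>\<open>q\<close> rounds suffice to exploit a disconnection, and \<open>l + 1\<close> rounds a difference of degrees; either
  ends the game. All other moves are paid for by the potential \<open>\<alpha> * ln s\<close>.\<close>

definition budget :: "nat \<Rightarrow> real" where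
  "budget s = real (q + l + 3) + \<alpha> * ln (real s)"

lemma budget_drop:
  assumes "1 \<le> k" "2 * k \<le> l + 1" "1 \<le> s'" "max 2 k * s' \<le> s" "budget s \<le> real (Suc (d + k))"
  shows "budget s' \<le> real d"
proof -
  have "ln (real (max 2 k)) + ln (real s') = ln (real (max 2 k * s'))"
    using assms(3) unfolding of_nat_mult by (subst ln_mult_pos) auto
  also have "\<dots> \<le> ln (real s)"
  proof -
    have pos: "0 < real (max 2 k * s')" unfolding of_nat_0_less_iff using assms(3) by simp
    have le: "real (max 2 k * s') \<le> real s" using assms(4) by (simp only: of_nat_le_iff)
    show ?thesis by (rule iffD2[OF ln_le_cancel_iff[OF pos less_le_trans[OF pos le]] le])
  qed
  finally have "\<alpha> * (ln (real (max 2 k)) + ln (real s')) \<le> \<alpha> * ln (real s)"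
    using \<alpha> by (rule mult_left_mono)
  then show ?thesis using \<alpha>_large[OF assms(1,2)] assms(5) by (simp add: budget_def algebra_simps)
qed

text \<open>One stage, with the smaller component on the left. Sizes are always estimated through
  left branches, which share \<open>s\<close> vertices, even when Spoiler pebbles neighbours on the
  right.\<close>

lemma spoiler_step:
  assumes pos: "position I l G H ps qs r r' R"
    and s: "card (component G (set ps) r) = s" "s \<le> card (component H (set qs) r')" "s \<le> n"
    and D: "budget s \<le> real D" and bf: "bf I G H D R"
    and IH: "\<And>ps qs x x' R D. position I l G H ps qs x x' R \<Longrightarrow>
      min (card (component G (set ps) x)) (card (component H (set qs) x')) < s \<Longrightarrow>
      budget (min (card (component G (set ps) x)) (card (component H (set qs) x'))) \<le> real D \<Longrightarrow>
      bf I G H D R \<Longrightarrow> piece_iso I G ps x H qs x'"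
  shows "piece_iso I G ps r H qs r'"
proof -
  have G: "treelike I G" and H: "treelike I H"
    and deg: "(\<forall>v\<in>verts G. degree G v \<le> l) \<or> (\<forall>v\<in>verts H. degree H v \<le> l)"
    and len: "length ps = length qs" and zip: "set (zip ps qs) \<subseteq> R" and rr: "(r, r') \<in> R"
    and r: "r \<notin> set ps" "r \<in> verts G" and r': "r' \<notin> set qs" "r' \<in> verts H"
    using pos by (auto simp: position_def)
  note gG = treelike_graph[OF G] and gH = treelike_graph[OF H]
  note ne = colored_graphD(2)[OF gG]
  let ?C = "component G (set ps) r" and ?C' = "component H (set qs) r'"
  obtain v where v: "v \<in> ?C" and centroid: "\<And>u. u \<in> nbrs G (set ps) v \<Longrightarrow> 2 * card (component G (insert v (set ps)) u) \<le> s"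
    using centroid_exists[OF G r] s(1) by blast
  have v_verts: "v \<in> verts G" using component_subset_verts[OF gG r(2)] v by blast
  have "1 \<le> s" using card_component_pos[OF gG r(2)] s(1) by blast
  then have "0 \<le> \<alpha> * ln (real s)" using \<alpha> by (intro mult_nonneg_nonneg) auto
  then have "real (q + l + 3) \<le> real D" using D by (simp add: budget_def)
  \<comment> \<open>After the centroid move at least \<open>q + l + 2\<close> rounds are left,
    enough for either threat.\<close>
  then have D_ge: "q + l + 3 \<le> D" by linarith
  then obtain D1 where D1: "D = Suc D1" by (cases D) auto
  from bf[unfolded D1 game.simps(2)] v_verts obtain v' where
    v': "v' \<in> verts H" and bf1: "bf I G H D1 (insert (v, v') R)" by blast
  let ?R = "insert (v, v') R"
  have zip1: "set (zip ps qs) \<subseteq> ?R" and vv: "(v, v') \<in> ?R" using zip by auto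
  note iso = bf_partial_iso[OF ne bf1]
  have v_notin: "v \<notin> set ps" using component_notin[OF v r(1)] .
  then have v'_notin: "v' \<notin> set qs" using pebbled_iff[OF iso len zip1 vv] by blast
  \<comment> \<open>With \<open>v'\<close> outside the component of \<open>r'\<close>, Spoiler would
    win by halving the walk from \<open>r\<close> to \<open>v\<close>.\<close>
  have v'_in: "v' \<in> ?C'"
  proof -
    obtain k where k: "k \<le> s * s" "(r, v) \<in> edges G (set ps) ^^ k"
      using short_walk[OF gG r(2) v] s(1) by blast
    have "s * s \<le> n * n" using s(3) by (intro mult_le_mono)
    then have "k \<le> 2 ^ q" using k(1) q by linarith
    have "bf I G H q ?R" by (rule bf_le[OF ne bf1]) (use D_ge D1 in simp)
    from bf_walk[OF gG this zip1, of r r' v v' k] rr r(2) k(2) \<open>k \<le> 2 ^ q\<close>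
    obtain k' where "(r', v') \<in> edges H (set qs) ^^ k'"
      unfolding fst_set_zip[OF len] snd_set_zip[OF len] by blast
    then show ?thesis by (auto simp: component_def dest: relpow_imp_rtrancl)
  qed
  have Cv: "component G (set ps) v = ?C" and Cv': "component H (set qs) v' = ?C'"
    using component_eq[OF gG v] component_eq[OF gH v'_in] .
  let ?N = "nbrs G (set ps) v" and ?N' = "nbrs H (set qs) v'"
  define t where "t = piece_type I G (v # ps)"
  define t' where "t' = piece_type I H (v' # qs)"
  let ?a = "\<lambda>u. card (component G (insert v (set ps)) u)" and ?b = "\<lambda>u. card (component H (insert v' (set qs)) u)"
  have finN: "finite ?N" "finite ?N'" using finite_nbrs gG gH by blast+
  have lN: "card ?N \<le> l \<or> card ?N' \<le> l"
    using deg v_verts v' card_nbrs_le[OF gG, of "set ps" v] card_nbrs_le[OF gH, of "set qs" v'] le_trans by blast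
  have card_eq: "card ?N = card ?N'"
    by (rule bf_nbrs_card_eq[OF gG gH bf1 len zip1 vv lN]) (use D_ge D1 in simp)
  have t_card: "?a u = ?a u2" if "t u = t u2" for u u2
    using piece_iso_card[of I G "v # ps" u G "v # ps" u2] that by (simp add: t_def piece_type_eq_iff)
  have t'_card: "?b w = ?b w2" if "t' w = t' w2" for w w2
    using piece_iso_card[of I H "v' # qs" w H "v' # qs" w2] that by (simp add: t'_def piece_type_eq_iff)
  have tt'_card: "?a u = ?b w" if "t u = t' w" for u w
    using piece_iso_card[of I G "v # ps" u H "v' # qs" w] that by (simp add: t_def t'_def piece_type_eq_iff)
  \<comment> \<open>\<open>Q\<close> holds the pebbled pairs of neighbours. If some pair had
    different types, then also one with a branch no larger than \<open>u0\<close>, the smallest left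
    branch: either the pair of \<open>u0\<close>, or any bad pair, since one side of
    \<open>Q\<close> has constant type and thus branches of the size of \<open>u0\<close>. The
    induction hypothesis applies to it.\<close>
  have same: "(\<forall>(u, w)\<in>Q. t u = t' w)"
    if Q: "finite Q" "Q \<subseteq> ?N \<times> ?N'" "inj_on fst Q" "1 \<le> card Q" "2 * card Q \<le> l + 1"
      and one: "(\<forall>(u, w)\<in>Q. t u = c) \<or> (\<forall>(u, w)\<in>Q. t' w = c)"
      and bfQ: "bf I G H d (?R \<union> Q)" and d: "D1 = d + card Q" for Q c d
  proof (rule ccontr)
    assume "\<not> ?thesis"
    then obtain u1 w1 where uw1: "(u1, w1) \<in> Q" "t u1 \<noteq> t' w1" by blast
    have "\<exists>p. p \<in> Q \<and> (\<forall>y. y \<in> Q \<longrightarrow> ?a (fst p) \<le> ?a (fst y))"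
      by (rule ex_has_least_nat[of "\<lambda>p. p \<in> Q" "(u1, w1)" "\<lambda>p. ?a (fst p)"]) (rule uw1(1))
    then obtain p where p: "p \<in> Q" "\<And>y. y \<in> Q \<Longrightarrow> ?a (fst p) \<le> ?a (fst y)" by blast
    obtain u0 w0 where "p = (u0, w0)" by (cases p)
    with p have uw0: "(u0, w0) \<in> Q" and least: "\<And>y. y \<in> Q \<Longrightarrow> ?a u0 \<le> ?a (fst y)" by simp_all
    have fstQ: "fst ` Q \<subseteq> ?N" using Q(2) by auto
    have "card Q * ?a u0 \<le> (\<Sum>p\<in>Q. ?a (fst p))"
      using sum_mono[of Q "\<lambda>_. ?a u0" "\<lambda>p. ?a (fst p)"] least by simp
    also have "\<dots> = (\<Sum>u\<in>fst ` Q. ?a u)" using Q(3) by (simp add: sum.reindex)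
    also have "\<dots> \<le> s" using sum_card_branches[OF G v_notin v_verts fstQ] s(1) Cv by simp
    finally have "card Q * ?a u0 \<le> s" .
    moreover have "2 * ?a u0 \<le> s" using centroid uw0 Q(2) by blast
    ultimately have small: "max 2 (card Q) * ?a u0 \<le> s" by (simp add: max_def)
    have "\<exists>u w. (u, w) \<in> Q \<and> t u \<noteq> t' w \<and> min (?a u) (?b w) \<le> ?a u0"
    proof (cases "t u0 = t' w0")
      case True
      have "min (?a u1) (?b w1) \<le> ?a u0"
        using one
      proof
        assume all: "\<forall>(u, w)\<in>Q. t u = c"
        have "t u1 = t u0" using bspec[OF all uw1(1)] bspec[OF all uw0] by simp
        from t_card[OF this] show ?thesis by simp
      next
        assume all: "\<forall>(u, w)\<in>Q. t' w = c"
        have "t' w1 = t u0" using bspec[OF all uw1(1)] bspec[OF all uw0] True by simp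
        from tt'_card[OF this[symmetric]] show ?thesis by simp
      qed
      then show ?thesis using uw1 by blast
    next
      case False
      then show ?thesis using uw0 by (intro exI[of _ u0] exI[of _ w0]) simp
    qed
    then obtain u w where uw: "(u, w) \<in> Q" "t u \<noteq> t' w" and min_le: "min (?a u) (?b w) \<le> ?a u0" by blast
    have uN: "u \<in> ?N" and wN: "w \<in> ?N'" using uw(1) Q(2) by auto
    have verts: "u \<in> verts G" "w \<in> verts H" using uN wN nbrs_verts[OF gG] nbrs_verts[OF gH] by blast+
    have pos_min: "1 \<le> min (?a u) (?b w)"
      using card_component_pos[OF gG verts(1)] card_component_pos[OF gH verts(2)] by simp
    have "max 2 (card Q) * min (?a u) (?b w) \<le> max 2 (card Q) * ?a u0" using min_le by (intro mult_le_mono2)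
    also note small
    finally have drop: "max 2 (card Q) * min (?a u) (?b w) \<le> s" .
    have "position I l G H (v # ps) (v' # qs) u w (?R \<union> Q)"
      unfolding position_def using G H deg len zip uw(1) verts nbrs_notin[OF gG uN] nbrs_notin[OF gH wN] by auto
    moreover have "2 * min (?a u) (?b w) \<le> max 2 (card Q) * min (?a u) (?b w)" by (intro mult_le_mono1) simp
    then have "min (?a u) (?b w) < s" using drop pos_min by linarith
    moreover have "budget (min (?a u) (?b w)) \<le> real d"
      by (rule budget_drop[OF Q(4,5) pos_min drop]) (use D D1 d in simp)
    ultimately have "piece_iso I G (v # ps) u H (v' # qs) w" using IH bfQ by simp
    then show False using uw(2) by (simp add: t_def t'_def piece_type_eq_iff)
  qed
  have "piece_iso I G ps v H qs v'"
    using finN lN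
  proof (cases rule: type_count_cases[where t = t and t' = t'])
    case (matched \<beta>)
    have "\<forall>i<length ps. adj G v (ps ! i) \<longleftrightarrow> adj H v' (qs ! i)"
    proof (intro allI impI)
      fix i assume "i < length ps"
      then have "(ps ! i, qs ! i) \<in> ?R" using zip len by (auto simp: set_zip)
      then show "adj G v (ps ! i) \<longleftrightarrow> adj H v' (qs ! i)" by (rule partial_iso_adj[OF iso vv])
    qed
    moreover have "\<forall>i\<in>I. v \<in> color G i \<longleftrightarrow> v' \<in> color H i" using partial_iso_color[OF iso vv] by blast
    moreover have "\<forall>u\<in>?N. piece_iso I G (v # ps) u H (v' # qs) (\<beta> u)"
      using matched(2) by (simp add: t_def t'_def piece_type_eq_iff)
    ultimately show ?thesis using piece_iso_glue[OF G H v_notin v'_notin len _ _ matched(1)] by blast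
  next
    case (left c U)
    have fin: "finite U" and sub: "U \<subseteq> verts G"
      using left(1) finN(1) nbrs_verts[OF gG] by (auto dest: finite_subset)
    have le: "card U \<le> D1" using left(4) D_ge D1 by simp
    have "bf I G H (D1 - card U + card U) ?R" using bf1 unfolding le_add_diff_inverse2[OF le] .
    from game_choose_left[OF fin sub this] obtain f where bfU: "bf I G H (D1 - card U) (?R \<union> (\<lambda>u. (u, f u)) ` U)"
      by blast
    let ?Q = "(\<lambda>u. (u, f u)) ` U"
    note isoU = bf_partial_iso[OF ne bfU]
    have cardQ: "card ?Q = card U" by (rule card_image) (auto simp: inj_on_def)
    have fU: "f ` U \<subseteq> ?N'" using nbrs_iff[OF isoU len, of v v'] zip1 left(1) by blast
    have inj: "inj_on f U" by (rule inj_onI) (use partial_iso_eq[OF isoU] in blast)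
    \<comment> \<open>So all answers have type \<open>c\<close>, although fewer than
      \<open>card U\<close> neighbours of \<open>v'\<close> do.\<close>
    have "\<forall>(u, w)\<in>?Q. t u = t' w"
    proof (rule same[where c = c])
      show "bf I G H (D1 - card U) (?R \<union> ?Q)" by (rule bfU)
      show "D1 = D1 - card U + card ?Q" using le cardQ by simp
    qed (use left fU fin in \<open>auto simp: cardQ inj_on_def\<close>)
    then have "f ` U \<subseteq> {w \<in> ?N'. t' w = c}" using left(2) fU by auto
    then have "card U \<le> card {w \<in> ?N'. t' w = c}"
      using inj finN(2) by (intro card_inj_on_le) auto
    then show ?thesis using left(5) by simp
  next
    case (right c U)
    have fin: "finite U" and sub: "U \<subseteq> verts H"
      using right(1) finN(2) nbrs_verts[OF gH] by (auto dest: finite_subset)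
    have le: "card U \<le> D1" using right(4) D_ge D1 by simp
    have "bf I G H (D1 - card U + card U) ?R" using bf1 unfolding le_add_diff_inverse2[OF le] .
    from bf_choose_right[OF fin sub this] obtain f where bfU: "bf I G H (D1 - card U) (?R \<union> (\<lambda>u. (f u, u)) ` U)"
      by blast
    let ?Q = "(\<lambda>u. (f u, u)) ` U"
    note isoU = bf_partial_iso[OF ne bfU]
    have cardQ: "card ?Q = card U" by (rule card_image) (auto simp: inj_on_def)
    have fU: "f ` U \<subseteq> ?N" using nbrs_iff[OF isoU len, of v v'] zip1 right(1) by blast
    have inj: "inj_on f U" by (rule inj_onI) (use partial_iso_eq[OF isoU] in blast)
    have "\<forall>(u, w)\<in>?Q. t u = t' w"
    proof (rule same[where c = c])
      show "bf I G H (D1 - card U) (?R \<union> ?Q)" by (rule bfU)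
      show "D1 = D1 - card U + card ?Q" using le cardQ by simp
    qed (use right fU fin inj in \<open>auto simp: cardQ inj_on_def\<close>)
    then have "f ` U \<subseteq> {u \<in> ?N. t u = c}" using right(2) fU by auto
    then have "card U \<le> card {u \<in> ?N. t u = c}"
      using inj finN(1) by (intro card_inj_on_le) auto
    then show ?thesis using right(5) by simp
  next
    case unequal
    then show ?thesis using card_eq by simp
  qed
  \<comment> \<open>\<open>piece_iso\<close> depends on its vertices only through their components,
    so \<open>r\<close> and \<open>r'\<close> may replace \<open>v\<close> and
    \<open>v'\<close>.\<close>
  then show ?thesis unfolding piece_iso_def Cv Cv' .
qed

text \<open>\<open>spoiler_step\<close> wants the smaller component on the left; if it is on the
  right, the game is converted and the isomorphism inverted.\<close>

lemma spoiler_wins: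
  "position I l G H ps qs r r' R \<Longrightarrow>
    s = min (card (component G (set ps) r)) (card (component H (set qs) r')) \<Longrightarrow> s \<le> n \<Longrightarrow>
    budget s \<le> real D \<Longrightarrow> bf I G H D R \<Longrightarrow> piece_iso I G ps r H qs r'"
proof (induction s arbitrary: G H ps qs r r' R D rule: less_induct)
  case (less s)
  let ?a = "card (component G (set ps) r)" and ?b = "card (component H (set qs) r')"
  show ?case
  proof (cases "?a \<le> ?b")
    case True
    then show ?thesis using less.prems
      by (intro spoiler_step[OF less.prems(1), of s D])
        (auto intro: less.IH[OF _ _ refl])
  next
    case False
    have "bf I H G D (R\<inverse>)" using less.prems(5) by (subst (asm) bf_converse)
    then have "piece_iso I H qs r' G ps r"
      using False less.prems(2-4)
      by (intro spoiler_step[OF position_converse[OF less.prems(1)], of s D])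
        (auto intro: less.IH[OF _ _ refl])
    then show ?thesis by (rule piece_iso_sym)
  qed
qed

text \<open>Once the competitor \<open>H\<close> is known to be connected and treelike, the
  components with nothing removed are the whole graphs. The 1 in \<open>1 + budget n\<close> pays
  for a first pebbled vertex.\<close>

lemma defining_sentence:
  assumes I: "finite I" and T: "T \<in> trees_upto I n l" and D: "1 + budget n \<le> real D" "q + 5 \<le> D"
  shows "\<exists>A. is_sentence I A \<and> defines_graph I A T \<and> quantifier_depth A \<le> D"
proof (rule defining_sentence_exists[OF I])
  have tree: "is_colored_tree I T" and n: "card (verts T) \<le> n" and deg: "\<forall>v\<in>verts T. degree T v \<le> l"
    using T by (auto simp: trees_upto_def)
  note G = tree_treelike[OF tree]
  note gG = treelike_graph[OF G]
  note ne = colored_graphD(2)[OF gG]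
  show "is_colored_graph I T" by (rule gG)
  show "1 \<le> D" using D(2) by simp
  fix H assume gH: "is_colored_graph I H" and bf: "bf I T H D {}"
  have conn: "connected_graph T" using tree by (simp add: is_colored_tree_def)
  have H: "treelike I H" and H_conn: "\<And>x. x \<in> verts H \<Longrightarrow> component H {} x = verts H"
    using treelike_transfer[OF G conn n gH q bf_le[OF ne bf D(2)]] by blast+
  obtain r where r: "r \<in> verts T" using ne by blast
  obtain D1 where D1: "D = Suc D1" using D(2) by (cases D) auto
  from bf[unfolded D1 game.simps(2)] r obtain r' where
    r': "r' \<in> verts H" and bf1: "bf I T H D1 {(r, r')}" by blast
  have comp: "component T {} r = verts T"
  proof
    show "component T {} r \<subseteq> verts T" by (rule component_subset_verts[OF gG r])
    show "verts T \<subseteq> component T {} r"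
    proof
      fix x assume "x \<in> verts T"
      then have "(adj T)\<^sup>*\<^sup>* r x" using conn r by (auto simp: connected_graph_def)
      then show "x \<in> component T {} r"
        by (induction rule: rtranclp_induct) (auto intro: component_step)
    qed
  qed
  let ?s = "min (card (component T (set []) r)) (card (component H (set []) r'))"
  have "1 \<le> ?s" using card_component_pos[OF gG r] card_component_pos[OF gH r'] by simp
  moreover have "?s \<le> n" using n comp by simp
  ultimately have "budget ?s \<le> budget n"
    unfolding budget_def using \<alpha> by (intro add_mono mult_left_mono order_refl) auto
  then have "budget ?s \<le> real D1" using D(1) D1 by simp
  moreover have "position I l T H [] [] r r' {(r, r')}"
    using G H deg r r' by (simp add: position_def)
  ultimately have "piece_iso I T [] r H [] r'"
    using spoiler_wins[OF _ refl \<open>?s \<le> n\<close>] bf1 by blast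
  then show "isomorphic I T H"
    unfolding piece_iso_def isomorphic_def list.set comp H_conn[OF r'] by blast
qed

end

subsection \<open>Bounds and asymptotics\<close>

text \<open>Of \<open>3 * ln n / ln 2\<close>, two thirds pay for walks of length up to
  \<open>n * n\<close>, and one third stems from the summand \<open>1 / ln 2\<close> of
  \<open>\<alpha>\<close>. The 6 is the 3 of \<open>budget\<close>, the first vertex and two
  roundings.\<close>

definition upper_bound :: "real \<Rightarrow> real \<Rightarrow> real" where
  "upper_bound n l = 3 * ln n / ln 2 + l + 6 + ((l + 1) / 2) / ln ((l + 1) / 2) * ln n"

text \<open>At least \<open>(l - 3) / 2\<close> rounds per level; rounding the number of levels down
  loses at most one.\<close>

definition lower_bound :: "real \<Rightarrow> real \<Rightarrow> real" where
  "lower_bound n l = (l - 3) / 2 * (ln (n / 2) / ln l - 1)"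

text \<open>\<open>K / ln K\<close> pays for the \<open>k\<close> neighbours, as
  \<open>ln x / x\<close> decreases beyond e, and \<open>1 / ln 2\<close> for the centroid. For
  \<open>k \<le> 2\<close> the comparison is made at 4, where \<open>4 / ln 4 = 2 / ln 2\<close>;
  hence \<open>4 \<le> K\<close>.\<close>

lemma cost_le_potential_drop:
  fixes K :: real and k :: nat
  assumes K: "4 \<le> K" and k: "1 \<le> k" "real k \<le> K"
  shows "1 + real k \<le> (K / ln K + 1 / ln 2) * ln (real (max 2 k))"
proof -
  have e: "exp 1 \<le> (3 :: real)" by (rule exp_le)
  have lnK: "0 < ln K" using K by simp
  have ln2: "0 < ln (2 :: real)" by simp
  show ?thesis
  proof (cases "k \<ge> 3")
    case True
    then have lnk: "0 < ln (real k)" by simp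
    have "ln K / K \<le> ln (real k) / real k"
      by (rule ln_x_over_x_mono) (use e True k in linarith)+
    then have "real k \<le> K / ln K * ln (real k)"
      using lnK K True by (simp add: field_simps)
    moreover have "1 \<le> 1 / ln 2 * ln (real k)"
      using ln2 True by (simp add: field_simps)
    moreover have max: "max 2 k = k" using True by simp
    ultimately show ?thesis unfolding max distrib_right by linarith
  next
    case False
    have "ln K / K \<le> ln 4 / 4"
      by (rule ln_x_over_x_mono) (use e K in linarith)+
    moreover have "ln 4 = 2 * ln (2 :: real)" using ln_realpow[of "2 :: real" 2] by simp
    ultimately have "2 \<le> K / ln K * ln 2"
      using lnK K by (simp add: field_simps)
    moreover have "max 2 k = 2" using False by simp
    ultimately show ?thesis using False ln2 by (simp add: algebra_simps)
  qed
qed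

lemma short_defining_sentence:
  assumes l: "7 \<le> l" and n: "1 \<le> n" and I: "finite I" and T: "T \<in> trees_upto I n l"
  shows "\<exists>A. is_sentence I A \<and> defines_graph I A T \<and> real (quantifier_depth A) \<le> upper_bound n l"
proof -
  define K where "K = (real l + 1) / 2"
  define q where "q = nat \<lceil>log 2 (real (n * n))\<rceil>"
  have K: "4 \<le> K" using l by (simp add: K_def)
  have lnn: "0 \<le> ln (real n)" using n by simp
  have log0: "0 \<le> log 2 (real (n * n))" using n by (simp add: log_def ln_mult)
  have "real (n * n) = 2 powr (log 2 (real (n * n)))" using n by simp
  also have "\<dots> \<le> 2 powr (real q)" using log0 unfolding q_def by (intro powr_mono) linarith+
  also have "\<dots> = real (2 ^ q)" by (simp add: powr_realpow)
  finally have qn: "n * n \<le> 2 ^ q" by (simp only: of_nat_le_iff)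
  have "real q \<le> log 2 (real (n * n)) + 1" using log0 unfolding q_def by linarith
  also have "log 2 (real (n * n)) = 2 * ln (real n) / ln 2" using n by (simp add: log_def ln_mult)
  finally have q_le: "real q \<le> 2 * ln (real n) / ln 2 + 1" .
  interpret spoiler I l n q "K / ln K + 1 / ln 2"
  proof
    show "0 \<le> K / ln K + 1 / ln 2" using K by (intro add_nonneg_nonneg divide_nonneg_nonneg) auto
    show "1 + real k \<le> (K / ln K + 1 / ln 2) * ln (real (max 2 k))" if "1 \<le> k" "2 * k \<le> l + 1" for k
    proof (rule cost_le_potential_drop[OF K that(1)])
      have "2 * real k \<le> real l + 1" using that(2) by linarith
      then show "real k \<le> K" by (simp add: K_def)
    qed
  qed (rule qn)
  have nonneg: "0 \<le> (K / ln K + 1 / ln 2) * ln (real n)"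
    using K lnn by (intro mult_nonneg_nonneg add_nonneg_nonneg divide_nonneg_nonneg) auto
  define D where "D = nat \<lceil>1 + budget n\<rceil>"
  have b: "real (q + l + 3) \<le> budget n" using nonneg by (simp add: budget_def)
  have D: "1 + budget n \<le> real D" "real D \<le> 2 + budget n" using b unfolding D_def by linarith+
  moreover have "q + 5 \<le> D" using D(1) b l by linarith
  ultimately obtain A where A: "is_sentence I A" "defines_graph I A T" "quantifier_depth A \<le> D"
    using defining_sentence[OF I T] by blast
  have "real (quantifier_depth A) \<le> 2 + budget n" using A(3) D(2) by linarith
  also have "budget n = real q + real l + 3 + K / ln K * ln (real n) + ln (real n) / ln 2"
    by (simp add: budget_def algebra_simps)
  also have "2 + \<dots> \<le> upper_bound n l"
    using q_le unfolding upper_bound_def K_def times_divide_eq_right[symmetric] by linarith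
  finally show ?thesis using A by blast
qed

lemma def_depth_upper_bound:
  assumes "7 \<le> l" "1 \<le> n" "finite I" "T \<in> trees_upto I n l"
  shows "real (def_depth I T) \<le> upper_bound n l"
proof -
  obtain A where A: "is_sentence I A" "defines_graph I A T" "real (quantifier_depth A) \<le> upper_bound n l"
    using short_defining_sentence[OF assms] by blast
  then show ?thesis using def_depth_le[OF A(1,2)] by linarith
qed

lemma def_depth_lower_bound:
  assumes l: "7 \<le> l" and n: "2 \<le> n"
  shows "\<exists>T\<in>trees_upto {} n l. lower_bound n l \<le> real (def_depth {} T)"
proof -
  define x where "x = ln (real n / 2) / ln (real l)"
  \<comment> \<open>The largest \<open>h\<close> with \<open>2 * h + 2 \<le> l\<close>; below,
    \<open>i\<close> is the largest number of levels with \<open>2 * l ^ i \<le> n\<close>.\<close>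
  define h where "h = (l - 2) div 2"
  define i where "i = nat \<lfloor>x\<rfloor>"
  have lnl: "0 < ln (real l)" using l by simp
  have x: "0 \<le> x" unfolding x_def using n lnl by (intro divide_nonneg_nonneg) auto
  have i: "real i \<le> x" "x - 1 \<le> real i" using x unfolding i_def by linarith+
  have h: "2 * h + 2 \<le> l" and "l \<le> 2 * h + 3" using l unfolding h_def by presburger+
  then have "real l \<le> real (2 * h + 3)" by (simp only: of_nat_le_iff)
  then have h': "(real l - 3) / 2 \<le> real h" by simp
  have "real ((2 * h + 2) ^ i) \<le> real l ^ i"
    unfolding of_nat_power using h by (intro power_mono) linarith+
  also have "\<dots> = real l powr real i" using l by (simp add: powr_realpow)
  also have "\<dots> \<le> real l powr x" using i(1) l by (intro powr_mono) auto
  also have "\<dots> = real n / 2" using l n lnl by (simp add: powr_def x_def)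
  finally have "2 * (2 * h + 2) ^ i \<le> n" by linarith
  then obtain T H where T: "T \<in> trees_upto {} n l" and H: "is_colored_graph {} H" "\<not> isomorphic {} T H"
    "bf {} T H (h * i) {}"
    using indistinguishable_trees[OF h] by blast
  have "is_colored_graph {} T" using T by (simp add: trees_upto_def is_colored_tree_def)
  moreover obtain A where "is_sentence {} A" "defines_graph {} A T"
    using short_defining_sentence[OF l _ _ T] n by auto
  ultimately have "h * i < def_depth {} T" using def_depth_greater H by blast
  then have "real h * real i \<le> real (def_depth {} T)" unfolding of_nat_mult[symmetric] of_nat_le_iff by simp
  moreover have "(real l - 3) / 2 * (x - 1) \<le> (real l - 3) / 2 * real i"
    using l i(2) by (intro mult_left_mono) auto
  moreover have "(real l - 3) / 2 * real i \<le> real h * real i"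
    using h' by (intro mult_right_mono) auto
  ultimately show ?thesis using T unfolding lower_bound_def x_def by (intro bexI[of _ T]) linarith+
qed

text \<open>\<open>Max\<close> is informative only on finite sets; finiteness comes from the upper
  bound, which is uniform in the color set \<open>I\<close>.\<close>

lemma D_tree_bounds:
  assumes l: "7 \<le> l" and n: "2 \<le> n"
  shows "lower_bound n l \<le> real (D_tree n l)" "real (D_tree n l) \<le> upper_bound n l"
proof -
  let ?S = "{def_depth I T | I T. finite I \<and> T \<in> trees_upto I n l}"
  have le: "real d \<le> upper_bound n l" if "d \<in> ?S" for d
    using that def_depth_upper_bound[OF l] n by auto
  have "?S \<subseteq> {..nat \<lfloor>upper_bound n l\<rfloor>}"
    by (intro subsetI, unfold atMost_iff) (rule le_nat_floor[OF le])
  then have fin: "finite ?S" by (rule finite_subset) simp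
  obtain T where T: "T \<in> trees_upto {} n l" "lower_bound n l \<le> real (def_depth {} T)"
    using def_depth_lower_bound[OF l n] by blast
  have mem: "def_depth {} T \<in> ?S" using T(1) by blast
  have "def_depth {} T \<le> D_tree n l" unfolding D_tree_def by (rule Max_ge[OF fin mem])
  then show "lower_bound n l \<le> real (D_tree n l)" using T(2) by linarith
  have "D_tree n l \<in> ?S" unfolding D_tree_def using fin mem by (intro Max_in) auto
  then show "real (D_tree n l) \<le> upper_bound n l" by (rule le)
qed

text \<open>After division by \<open>main\<close>, the logarithmic error is a multiple of
  \<open>ln l / l\<close>, the linear one is \<open>1 + 6 / l\<close> divided by
  \<open>ln n / ln l\<close>, and the last term of \<open>upper_bound\<close> depends on
  \<open>l\<close> alone and tends to 1 / 2.\<close>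

lemma bounds_asymptotics:
  fixes l :: "nat \<Rightarrow> nat"
  assumes l: "filterlim l at_top at_top"
    and x: "filterlim (\<lambda>n. ln (real n) / ln (real (l n))) at_top at_top"
  defines "main \<equiv> \<lambda>n. real (l n) * ln (real n) / ln (real (l n))"
  shows "((\<lambda>n. upper_bound n (l n) / main n) \<longlongrightarrow> 1 / 2) at_top"
    and "((\<lambda>n. lower_bound n (l n) / main n) \<longlongrightarrow> 1 / 2) at_top"
proof -
  let ?x = "\<lambda>n. ln (real n) / ln (real (l n))"
  have L: "filterlim (\<lambda>n. real (l n)) at_top at_top"
    by (rule filterlim_compose[OF filterlim_real_sequentially l])
  have lim: "((\<lambda>n. g (real (l n))) \<longlongrightarrow> c) at_top" if "(g \<longlongrightarrow> c) at_top" for g :: "real \<Rightarrow> real" and c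
    by (rule filterlim_compose[OF that L])
  have inv: "((\<lambda>n. 1 / ?x n) \<longlongrightarrow> 0) at_top"
    using filterlim_compose[OF tendsto_inverse_0 filterlim_at_top_imp_at_infinity[OF x]]
    by (simp only: inverse_eq_divide)
  have big: "\<forall>\<^sub>F n in at_top. 7 \<le> l n \<and> 2 \<le> n"
    using l by (intro eventually_conj) (auto simp: filterlim_at_top eventually_ge_at_top)
  have "((\<lambda>n. 3 / ln 2 * (ln (real (l n)) / real (l n)) + (1 + 6 / real (l n)) * (1 / ?x n) +
      (real (l n) + 1) / 2 / ln ((real (l n) + 1) / 2) * ln (real (l n)) / real (l n))
      \<longlongrightarrow> 3 / ln 2 * 0 + 1 * 0 + 1 / 2) at_top"
  proof (intro tendsto_add tendsto_mult inv tendsto_const)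
    show "((\<lambda>n. ln (real (l n)) / real (l n)) \<longlongrightarrow> 0) at_top"
      by (rule lim) real_asymp
    show "((\<lambda>n. 1 + 6 / real (l n)) \<longlongrightarrow> 1) at_top"
      by (rule lim) real_asymp
    show "((\<lambda>n. (real (l n) + 1) / 2 / ln ((real (l n) + 1) / 2) * ln (real (l n)) / real (l n)) \<longlongrightarrow> 1 / 2) at_top"
      by (rule lim) real_asymp
  qed
  moreover have "\<forall>\<^sub>F n in at_top. 3 / ln 2 * (ln (real (l n)) / real (l n)) + (1 + 6 / real (l n)) * (1 / ?x n) +
      (real (l n) + 1) / 2 / ln ((real (l n) + 1) / 2) * ln (real (l n)) / real (l n) =
      upper_bound n (l n) / main n"
    using big
  proof eventually_elim
    case (elim n)
    then have "0 < ln (real n)" "0 < ln (real (l n))" "0 < real (l n)" "0 < ln ((real (l n) + 1) / 2)" by auto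
    then show ?case unfolding upper_bound_def main_def by (simp add: divide_simps) (simp add: algebra_simps)
  qed
  ultimately show "((\<lambda>n. upper_bound n (l n) / main n) \<longlongrightarrow> 1 / 2) at_top"
    by (simp add: tendsto_cong)
  have "((\<lambda>n. (real (l n) - 3) / (2 * real (l n)) * (1 - ln 2 / ln (real (l n)) * (1 / ?x n) - 1 / ?x n))
      \<longlongrightarrow> 1 / 2 * (1 - 0 * 0 - 0)) at_top"
  proof (intro tendsto_diff tendsto_mult inv tendsto_const)
    show "((\<lambda>n. (real (l n) - 3) / (2 * real (l n))) \<longlongrightarrow> 1 / 2) at_top"
      by (rule lim) real_asymp
    show "((\<lambda>n. ln 2 / ln (real (l n))) \<longlongrightarrow> 0) at_top"
      by (rule lim) real_asymp
  qed
  moreover have "\<forall>\<^sub>F n in at_top. (real (l n) - 3) / (2 * real (l n)) *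
      (1 - ln 2 / ln (real (l n)) * (1 / ?x n) - 1 / ?x n) = lower_bound n (l n) / main n"
    using big
  proof eventually_elim
    case (elim n)
    then have pos: "0 < ln (real n)" "0 < ln (real (l n))" "0 < real (l n)" by auto
    have "ln (real n / 2) = ln (real n) - ln 2" using elim by (simp add: ln_div)
    then show ?case using pos unfolding lower_bound_def main_def by (simp add: divide_simps)
  qed
  ultimately show "((\<lambda>n. lower_bound n (l n) / main n) \<longlongrightarrow> 1 / 2) at_top"
    by (simp add: tendsto_cong)
qed

theorem theorem1:
  fixes l :: "nat \<Rightarrow> nat"
  assumes "filterlim l at_top at_top"
    and "filterlim (\<lambda>n. ln (real n) / ln (real (l n))) at_top at_top"
  shows "(\<exists>\<epsilon> :: nat \<Rightarrow> real. \<epsilon> \<in> o(\<lambda>_. 1) \<and>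
            (\<forall>\<^sub>F n in at_top.
               real (D_tree n (l n)) =
                 (1 / 2 + \<epsilon> n) * (real (l n) * ln (real n) / ln (real (l n))))) \<and>
         (\<exists>\<delta> :: nat \<Rightarrow> real. \<delta> \<in> o(\<lambda>_. 1) \<and>
            (\<forall>\<^sub>F n in at_top. \<exists>T \<in> trees_upto {} n (l n).
               real (def_depth {} T) \<ge>
                 (1 / 2 - \<delta> n) * (real (l n) * ln (real n) / ln (real (l n)))))"
proof -
  define main where "main n = real (l n) * ln (real n) / ln (real (l n))" for n
  note lims = bounds_asymptotics[OF assms, folded main_def]
  have big: "\<forall>\<^sub>F n in at_top. 7 \<le> l n \<and> 2 \<le> n"
    using assms(1) by (intro eventually_conj) (auto simp: filterlim_at_top eventually_ge_at_top)
  have main_pos: "main n > 0" if "7 \<le> l n \<and> 2 \<le> n" for n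
    unfolding main_def using that by (intro divide_pos_pos mult_pos_pos) auto
  have "((\<lambda>n. real (D_tree n (l n)) / main n) \<longlongrightarrow> 1 / 2) at_top"
  proof (rule tendsto_sandwich[OF _ _ lims(2) lims(1)])
    show "\<forall>\<^sub>F n in at_top. lower_bound n (l n) / main n \<le> real (D_tree n (l n)) / main n"
      using big
    proof eventually_elim
      case (elim n)
      then show ?case using D_tree_bounds(1)[of "l n" n] main_pos[of n] by (simp add: divide_right_mono)
    qed
    show "\<forall>\<^sub>F n in at_top. real (D_tree n (l n)) / main n \<le> upper_bound n (l n) / main n"
      using big
    proof eventually_elim
      case (elim n)
      then show ?case using D_tree_bounds(2)[of "l n" n] main_pos[of n] by (simp add: divide_right_mono)
    qed
  qed
  then have "((\<lambda>n. real (D_tree n (l n)) / main n - 1 / 2) \<longlongrightarrow> 0) at_top"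
    by (simp add: LIM_zero)
  then have "(\<lambda>n. real (D_tree n (l n)) / main n - 1 / 2) \<in> o(\<lambda>_. 1)"
    by (intro smalloI_tendsto) simp_all
  moreover have "\<forall>\<^sub>F n in at_top. real (D_tree n (l n)) =
      (1 / 2 + (real (D_tree n (l n)) / main n - 1 / 2)) * main n"
    using big by eventually_elim (use main_pos in fastforce)
  moreover have "((\<lambda>n. 1 / 2 - lower_bound n (l n) / main n) \<longlongrightarrow> 1 / 2 - 1 / 2) at_top"
    by (intro tendsto_diff tendsto_const lims(2))
  then have "(\<lambda>n. 1 / 2 - lower_bound n (l n) / main n) \<in> o(\<lambda>_. 1)"
    by (intro smalloI_tendsto) simp_all
  moreover have "\<forall>\<^sub>F n in at_top. \<exists>T \<in> trees_upto {} n (l n).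
      real (def_depth {} T) \<ge> (1 / 2 - (1 / 2 - lower_bound n (l n) / main n)) * main n"
    using big
  proof eventually_elim
    case (elim n)
    then have "(1 / 2 - (1 / 2 - lower_bound n (l n) / main n)) * main n = lower_bound n (l n)"
      using main_pos[OF elim] by simp
    then show ?case using def_depth_lower_bound elim by simp
  qed
  ultimately show ?thesis unfolding main_def by (intro conjI exI) blast+
qed

end
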